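(* Let $k\in\mathbb{N}$ and $d\in\mathbb{R}$. Let $P(\zeta)$ be a polynomial of degree $q$ with complex coefficients such that $P(0)\neq 0$, and let $a_1,\dots,a_l\in\mathbb{C}$ be the (distinct) roots of $P(\zeta)=0$, with multiplicities $p_1,\dots,p_l$ respectively, $\sum_{i=1}^l p_i=q$. Let $f(z)$ be holomorphic in a complex neighbourhood of the origin, and let $\hat{x}(\varepsilon,z)\in\mathbb{E}[[\varepsilon]]$ be a formal solution of the equation $$P\left(\varepsilon^k\frac{d}{dz}\right)x(\varepsilon,z)=f(z).$$ Then the following are equivalent: (i) for every $i=1,\dots,l$, $f$ can be continued analytically in some sector in the direction $kd-\arg a_i$ and its continuation is of exponential growth of order (at most) $1$; (ii) $\hat{x}(\varepsilon,z)$ is $k$-summable in the direction $d$.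
   Context: $D_r=\{z\in\mathbb{C}:|z|<r\}$. Here $\mathbb{E}$ is the Banach space $\mathcal{O}$ of functions holomorphic on $D_r$ and continuous on $\overline{D}_r$, for some $r>0$, with norm $\|\varphi\|=\sup_{|z|\le r}|\varphi(z)|$; the radius $r$ is not prescribed and may be decreased if necessary. $\mathbb{E}[[\varepsilon]]$ is the space of formal power series $\sum_{n\ge0}x_n(z)\varepsilon^n$ with $x_n\in\mathbb{E}$; $\frac{d}{dz}$ acts coefficientwise. Sectors: $S(d,\alpha)=\{\rho e^{i\phi}:\rho>0,\ |\phi-d|<\alpha/2\}$ and $\hat{S}_d(\alpha,r)=S(d,\alpha)\cup D_r$, written $\hat{S}_d$ when $\alpha>0$ and $r>0$ are unimportant. A (Banach-space valued) function $g$ holomorphic on $\hat{S}_d(\alpha,r)$ has exponential growth at most $K$ there if for every $\alpha'\in(0,\alpha)$, $r'\in(0,r)$ there are constants $C,a<\infty$ with $\|g(t)\|\le Ce^{a|t|^K}$ on $\hat{S}_d(\alpha',r')$. Saying that $f$ continues analytically in some sector in direction $\theta$ with exponential growth of order $K$ means that $f$ extends to a holomorphic function of exponential growth at most $K$ on some $\hat{S}_\theta(\alpha,r)$. Summability: for $K>0$, $\hat{\mathcal{B}}_K\big(\sum x_n\varepsilon^n\big)=\sum \frac{x_n}{\Gamma(1+n/K)}\varepsilon^n$. A series $\hat{x}\in\mathbb{E}[[\varepsilon]]$ is $K$-summable in the direction $d$ if $\hat{\mathcal{B}}_K\hat{x}$ converges near $\varepsilon=0$ and its sum extends to an $\mathbb{E}$-valued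 holomorphic function on some $\hat{S}_d$ with exponential growth at most $K$. *)

theory Defs
  imports "HOL-Complex_Analysis.Complex_Analysis"
begin

definition sector :: "real \<Rightarrow> real \<Rightarrow> complex set" where
  "sector d \<alpha> = {rcis \<rho> \<phi> |\<rho> \<phi>. \<rho> > 0 \<and> \<bar>\<phi> - d\<bar> < \<alpha> / 2}"

definition sector_hat :: "real \<Rightarrow> real \<Rightarrow> real \<Rightarrow> complex set" where
  "sector_hat d \<alpha> r = sector d \<alpha> \<union> ball 0 r"

(* The Banach space of functions holomorphic on the open disc of radius r and continuous on the
   closed one. Its elements are represented by total functions whose values outside the closed
   disc are irrelevant: the norm and all conditions below only look at the closed disc. *)

definition disc_space :: "real \<Rightarrow> (complex \<Rightarrow> complex) set" where
  "disc_space r = {\<phi>. \<phi> holomorphic_on ball 0 r \<and> continuous_on (cball 0 r) \<phi>}"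

definition disc_norm :: "real \<Rightarrow> (complex \<Rightarrow> complex) \<Rightarrow> real" where
  "disc_norm r \<phi> = (SUP z\<in>cball 0 r. cmod (\<phi> z))"

definition disc_sums :: "real \<Rightarrow> (nat \<Rightarrow> complex \<Rightarrow> complex) \<Rightarrow> (complex \<Rightarrow> complex) \<Rightarrow> bool" where
  "disc_sums r u \<phi> \<longleftrightarrow> \<phi> \<in> disc_space r \<and>
     (\<lambda>N. disc_norm r (\<lambda>z. (\<Sum>n<N. u n z) - \<phi> z)) \<longlonglongrightarrow> 0"

(* Complex differentiability, in norm, of a function with values in disc_space r; meant for
   open sets only. *)

definition disc_holomorphic_on ::
    "real \<Rightarrow> (complex \<Rightarrow> complex \<Rightarrow> complex) \<Rightarrow> complex set \<Rightarrow> bool" where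
  "disc_holomorphic_on r G \<Omega> \<longleftrightarrow> (\<forall>t\<in>\<Omega>. G t \<in> disc_space r \<and>
     (\<exists>D\<in>disc_space r.
        ((\<lambda>h. disc_norm r (\<lambda>z. (G (t + h) z - G t z) / h - D z)) \<longlongrightarrow> 0) (at 0)))"

(* N t stands for the norm of g t, so that the same notion serves scalar and
   disc_space-valued functions g. *)

definition exp_growth :: "real \<Rightarrow> real \<Rightarrow> real \<Rightarrow> real \<Rightarrow> (complex \<Rightarrow> real) \<Rightarrow> bool" where
  "exp_growth K d \<alpha> r N \<longleftrightarrow>
     (\<forall>\<alpha>'\<in>{0<..<\<alpha>}. \<forall>r'\<in>{0<..<r}. \<exists>C a :: real.
        \<forall>t\<in>sector_hat d \<alpha>' r'. N t \<le> C * exp (a * cmod t powr K))"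

(* Only the germ of f at the origin is continued. *)

definition continues_with_exp_growth :: "(complex \<Rightarrow> complex) \<Rightarrow> real \<Rightarrow> real \<Rightarrow> bool" where
  "continues_with_exp_growth f K \<theta> \<longleftrightarrow>
     (\<exists>\<alpha>>0. \<exists>r>0. \<exists>g. g holomorphic_on sector_hat \<theta> \<alpha> r \<and>
        (\<forall>\<^sub>F z in nhds 0. g z = f z) \<and>
        exp_growth K \<theta> \<alpha> r (\<lambda>t. cmod (g t)))"

(* A formal power series in epsilon with coefficients in disc_space r is given by its
   coefficient sequence x. *)

definition formal_borel ::
    "real \<Rightarrow> (nat \<Rightarrow> complex \<Rightarrow> complex) \<Rightarrow> nat \<Rightarrow> complex \<Rightarrow> complex" where
  "formal_borel K x n z = x n z / complex_of_real (Gamma (1 + real n / K))"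

definition formal_summable :: "real \<Rightarrow> real \<Rightarrow> real \<Rightarrow> (nat \<Rightarrow> complex \<Rightarrow> complex) \<Rightarrow> bool" where
  "formal_summable r K d x \<longleftrightarrow> (\<forall>n. x n \<in> disc_space r) \<and>
     (\<exists>\<alpha>>0. \<exists>\<rho>>0. \<exists>G. disc_holomorphic_on r G (sector_hat d \<alpha> \<rho>) \<and>
        exp_growth K d \<alpha> \<rho> (\<lambda>t. disc_norm r (G t)) \<and>
        (\<exists>\<delta>>0. \<forall>t\<in>ball 0 \<delta>. disc_sums r (\<lambda>n z. formal_borel K x n z * t ^ n) (G t)))"

(* The operator epsilon^k d/dz on coefficient sequences. *)

definition eps_deriv ::
    "nat \<Rightarrow> (nat \<Rightarrow> complex \<Rightarrow> complex) \<Rightarrow> nat \<Rightarrow> complex \<Rightarrow> complex" where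
  "eps_deriv k x n = (if n < k then (\<lambda>_. 0) else deriv (x (n - k)))"

definition poly_eps_deriv ::
    "complex poly \<Rightarrow> nat \<Rightarrow> (nat \<Rightarrow> complex \<Rightarrow> complex) \<Rightarrow> nat \<Rightarrow> complex \<Rightarrow> complex" where
  "poly_eps_deriv P k x n z = (\<Sum>j\<le>degree P. coeff P j * (eps_deriv k ^^ j) x n z)"

(* The derivatives need not extend continuously to the closed disc, hence the equation is
   required on the open disc. *)

definition formal_solution ::
    "real \<Rightarrow> complex poly \<Rightarrow> nat \<Rightarrow> (complex \<Rightarrow> complex) \<Rightarrow> (nat \<Rightarrow> complex \<Rightarrow> complex) \<Rightarrow> bool" where
  "formal_solution r P k f x \<longleftrightarrow> (\<forall>n. x n \<in> disc_space r) \<and>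
     (\<forall>n. \<forall>z\<in>ball 0 r. poly_eps_deriv P k x n z = (if n = 0 then f z else 0))"

end

(* The formal solution is x_n = c_m f^(m) for n = k m and x_n = 0 otherwise, where
   sum_m c_m zeta^m = 1/P(zeta). Hence the Borel transform is H(t^k, z) with
   H(s, z) = sum_m c_m f^(m)(z) s^m / m!.
   (i) ==> (ii): by partial fractions c_m is a combination of binom(m, i) b^(-m) for roots b of P,
   and such a term contributes u^i f^(i)(z + u) / i! with u = s / b, a function of t continuing to
   a sector in direction d because f continues in direction k d - arg b.
   (ii) ==> (i): for a root a put Q = P / (zeta - a). Applying Q(d_s^(-1) d_z) to H gives
   - f(z + s / a) / a; at z = 0 the z-derivatives of H are controlled by Cauchy's inequality, and
   integration in s preserves exponential growth. *)

theory Submission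
  imports Defs
begin

section \<open>Sectors\<close>

text \<open>Multiplicities leave no trace in condition (i), because derivatives of f inherit its
  exponential type on slightly smaller sectors, and a factor u^i is absorbed by raising the
  exponential rate. The cofactor is what separates the roots: the coefficients of 1/P mix all of
  them, while Q/P = 1/(\<zeta> - a) has a pure geometric series. In that direction the Banach-valued
  sum is only tested by the functionals \<phi> -> \<phi>^(j)(0), so the argument becomes a calculus
  of scalar power series in s. In the other direction the obstacle is uniformity. Each partial
  fraction puts its own limits on the opening, on the disc in t and on the radius in z; one
  parameter \<eta> tending to 0 controls all three. Holomorphy and convergence are first proved for
  each fixed z, and a common bound then turns them into statements in norm. Between t and s = t^k, a
  branch of the k-th root is available only inside the sector; around 0 the power series in s takes
  its place.\<close>

lemma sector_mult_rcis:
  assumes "w \<in> sector d \<alpha>" "\<rho> > 0" "\<bar>\<phi> - d'\<bar> \<le> \<epsilon>"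
  shows "w * rcis \<rho> \<phi> \<in> sector (d + d') (\<alpha> + 2 * \<epsilon>)"
proof -
  obtain \<sigma> \<psi> where w: "w = rcis \<sigma> \<psi>" "\<sigma> > 0" "\<bar>\<psi> - d\<bar> < \<alpha> / 2"
    using assms(1) by (auto simp: sector_def)
  have "w * rcis \<rho> \<phi> = rcis (\<sigma> * \<rho>) (\<psi> + \<phi>)"
    by (simp add: w rcis_mult)
  moreover have "\<bar>\<psi> + \<phi> - (d + d')\<bar> < (\<alpha> + 2 * \<epsilon>) / 2"
  proof -
    have "\<bar>(\<psi> - d) + (\<phi> - d')\<bar> < \<alpha> / 2 + \<epsilon>"
      using w(3) assms(3) by linarith
    then show ?thesis by (simp add: algebra_simps add_divide_distrib)
  qed
  ultimately show ?thesis
    unfolding sector_def using w(2) assms(2) by (blast intro: mult_pos_pos)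
qed

lemma sector_mult:
  assumes "w \<in> sector d \<alpha>" "c \<noteq> 0"
  shows "w * c \<in> sector (d + Arg c) \<alpha>"
  using sector_mult_rcis[OF assms(1), of "cmod c" "Arg c" "Arg c" 0] assms(2)
  by (simp add: rcis_cmod_Arg)

lemma sector_divide:
  assumes "w \<in> sector d \<alpha>" "c \<noteq> 0"
  shows "w / c \<in> sector (d - Arg c) \<alpha>"
proof -
  have "inverse c = rcis (inverse (cmod c)) (- Arg c)"
    using assms(2) by (metis rcis_cmod_Arg rcis_inverse inverse_eq_divide)
  then show ?thesis
    using sector_mult_rcis[OF assms(1), of "inverse (cmod c)" "- Arg c" "- Arg c" 0] assms(2)
    by (simp add: divide_inverse)
qed

lemma sector_scaleR:
  assumes "w \<in> sector d \<alpha>" "c > 0"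
  shows "of_real c * w \<in> sector d \<alpha>"
  using sector_mult_rcis[OF assms(1), of c 0 0 0] assms(2) by (simp add: rcis_def mult.commute)

lemma sector_power:
  assumes "t \<in> sector d \<alpha>" "k \<ge> 1"
  shows "t ^ k \<in> sector (real k * d) (real k * \<alpha>)"
proof -
  obtain \<rho> \<phi> where t: "t = rcis \<rho> \<phi>" "\<rho> > 0" "\<bar>\<phi> - d\<bar> < \<alpha> / 2"
    using assms by (auto simp: sector_def)
  have "\<bar>real k * \<phi> - real k * d\<bar> = real k * \<bar>\<phi> - d\<bar>"
    by (metis abs_mult abs_of_nat right_diff_distrib)
  also have "\<dots> < real k * \<alpha> / 2"
    using t(3) assms(2) by simp
  finally show ?thesis
    unfolding sector_def t(1) using t(2) by (auto simp: DeMoivre2 intro!: exI)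
qed

lemma sector_hat_mono:
  assumes "\<alpha> \<le> \<alpha>'" "r \<le> r'"
  shows "sector_hat d \<alpha> r \<subseteq> sector_hat d \<alpha>' r'"
proof -
  have "sector d \<alpha> \<subseteq> sector d \<alpha>'"
    unfolding sector_def using assms(1) by (fastforce intro: less_le_trans)
  then show ?thesis using assms(2) by (force simp: sector_hat_def)
qed

text \<open>Origin of the direction in condition (i): the power multiplies angles by
  \<open>k\<close>, and division by a root subtracts its argument.\<close>

lemma sector_hat_power_divide:
  assumes "t \<in> sector_hat d \<alpha> r" "k \<ge> 1" "c \<noteq> 0" "r \<ge> 0"
  shows "t ^ k / c \<in> sector_hat (real k * d - Arg c) (real k * \<alpha>) (r ^ k / cmod c)"
proof (cases "t \<in> sector d \<alpha>")
  case True
  then show ?thesis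
    using sector_divide[OF sector_power] assms by (simp add: sector_hat_def)
next
  case False
  then have "cmod t < r" using assms(1) by (simp add: sector_hat_def)
  then have "cmod t ^ k < r ^ k" using assms(2) by (intro power_strict_mono) auto
  then show ?thesis
    using assms(3) by (simp add: sector_hat_def norm_divide norm_power divide_strict_right_mono)
qed

lemma Arg_small_near_1:
  assumes "\<epsilon> > 0"
  obtains e where "0 < e" "e < 1" "\<And>v. cmod (v - 1) < e \<Longrightarrow> v \<noteq> 0 \<and> \<bar>Arg v\<bar> \<le> \<epsilon>"
proof -
  have "continuous (at 1) Arg"
    by (rule continuous_at_Arg) simp
  then have "(Arg \<longlongrightarrow> 0) (at 1)"
    by (simp add: continuous_at)
  then obtain e where e: "e > 0" "\<And>v. v \<noteq> 1 \<Longrightarrow> dist v 1 < e \<Longrightarrow> dist (Arg v) 0 < \<epsilon>"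
    using assms by (auto simp: tendsto_iff eventually_at)
  show ?thesis
  proof (rule that[of "min e (1/2)"])
    fix v :: complex assume v: "cmod (v - 1) < min e (1/2)"
    have "v \<noteq> 0" using v by auto
    moreover have "\<bar>Arg v\<bar> \<le> \<epsilon>"
      using e(2)[of v] v assms by (cases "v = 1") (auto simp: dist_norm)
    ultimately show "v \<noteq> 0 \<and> \<bar>Arg v\<bar> \<le> \<epsilon>" by simp
  qed (use e in auto)
qed

text \<open>Sectors are invariant under scaling, so the tolerance has to be relative to
  \<open>cmod w\<close>: dividing by \<open>w\<close> reduces everything to continuity of
  \<open>Arg\<close> at 1. Hence \<open>e\<close> depends on \<epsilon> alone.\<close>

lemma sector_wiggle:
  assumes "\<epsilon> > 0"
  obtains e where "0 < e" "e < 1"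
    "\<And>d \<alpha> w v. w \<in> sector d \<alpha> \<Longrightarrow> cmod (v - w) < e * cmod w \<Longrightarrow> v \<in> sector d (\<alpha> + \<epsilon>)"
proof -
  obtain e where e: "0 < e" "e < 1" "\<And>v. cmod (v - 1) < e \<Longrightarrow> v \<noteq> 0 \<and> \<bar>Arg v\<bar> \<le> \<epsilon> / 2"
    using Arg_small_near_1[of "\<epsilon> / 2"] assms by (metis half_gt_zero)
  show ?thesis
  proof (rule that[OF e(1,2)])
    fix d \<alpha> w v assume w: "w \<in> sector d \<alpha>" and v: "cmod (v - w) < e * cmod w"
    have w0: "w \<noteq> 0" using v by auto
    have "v / w - 1 = (v - w) / w" using w0 by (simp add: field_simps)
    then have "cmod (v / w - 1) < e"
      using v w0 by (simp add: norm_divide field_simps)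
    from e(3)[OF this] have "v / w \<noteq> 0" "\<bar>Arg (v / w)\<bar> \<le> \<epsilon> / 2" by auto
    with sector_mult_rcis[OF w, of "cmod (v / w)" "Arg (v / w)" 0 "\<epsilon> / 2"]
    show "v \<in> sector d (\<alpha> + \<epsilon>)"
      using w0 by (simp add: rcis_cmod_Arg)
  qed
qed

text \<open>One radius serves all points although the set is unbounded: inside the disc of radius
  \<open>r'\<close> there is room \<open>r - r'\<close>, and outside it the relative tolerance of
  the sector is at least \<open>e * r'\<close>. This uniformity lets Cauchy estimates preserve
  exponential growth.\<close>

lemma sector_hat_cball_subset:
  assumes "\<alpha>' < \<alpha>" "0 < r'" "r' < r"
  obtains e where "0 < e" "\<And>w. w \<in> sector_hat d \<alpha>' r' \<Longrightarrow> cball w e \<subseteq> sector_hat d \<alpha> r"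
proof -
  obtain e where e: "0 < e" "e < 1"
    "\<And>d \<beta> w v. w \<in> sector d \<beta> \<Longrightarrow> cmod (v - w) < e * cmod w \<Longrightarrow> v \<in> sector d (\<beta> + (\<alpha> - \<alpha>'))"
    using sector_wiggle[of "\<alpha> - \<alpha>'"] assms by (metis diff_gt_0_iff_gt)
  define e0 where "e0 = min (e * r') (r - r') / 2"
  have e0: "0 < e0" "e0 < e * r'" "e0 < r - r'"
    using e(1) assms by (auto simp: e0_def min_def field_simps)
  show ?thesis
  proof (rule that[OF e0(1)], rule subsetI)
    fix w v assume w: "w \<in> sector_hat d \<alpha>' r'" and v: "v \<in> cball w e0"
    show "v \<in> sector_hat d \<alpha> r"
    proof (cases "cmod w < r'")
      case True
      have "cmod v \<le> cmod w + dist w v"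
        using norm_triangle_ineq[of w "v - w"] by (simp add: dist_norm norm_minus_commute)
      then show ?thesis using v True e0 by (simp add: sector_hat_def)
    next
      case False
      then have "w \<in> sector d \<alpha>'" using w by (simp add: sector_hat_def)
      moreover have "cmod (v - w) < e * cmod w"
      proof -
        have "cmod (v - w) \<le> e0" using v by (simp add: dist_norm norm_minus_commute)
        also have "e0 < e * r'" by (rule e0)
        also have "e * r' \<le> e * cmod w" using False e(1) by simp
        finally show ?thesis .
      qed
      ultimately have "v \<in> sector d (\<alpha>' + (\<alpha> - \<alpha>'))" by (rule e(3))
      then show ?thesis by (simp add: sector_hat_def)
    qed
  qed
qed

lemma open_sector: "open (sector d \<alpha>)"
proof (rule openI)
  fix w assume w: "w \<in> sector d \<alpha>"
  then obtain \<rho> \<phi> where p: "w = rcis \<rho> \<phi>" "\<rho> > 0" "\<bar>\<phi> - d\<bar> < \<alpha> / 2"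
    by (auto simp: sector_def)
  \<comment> \<open>An intermediate opening that still contains \<open>w\<close>; the slack \<alpha>
    - \<beta> is spent on the perturbation.\<close>
  then obtain \<beta> where b: "\<bar>\<phi> - d\<bar> < \<beta> / 2" "\<beta> < \<alpha>"
    using dense[of "2 * \<bar>\<phi> - d\<bar>" \<alpha>] by (auto simp: mult.commute)
  have wb: "w \<in> sector d \<beta>" using p b by (auto simp: sector_def)
  obtain e where e: "0 < e" "e < 1"
    "\<And>d \<gamma> w v. w \<in> sector d \<gamma> \<Longrightarrow> cmod (v - w) < e * cmod w \<Longrightarrow> v \<in> sector d (\<gamma> + (\<alpha> - \<beta>))"
    using sector_wiggle[of "\<alpha> - \<beta>"] b by (metis diff_gt_0_iff_gt)
  have "ball w (e * cmod w) \<subseteq> sector d \<alpha>"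
    using e(3)[OF wb] by (auto simp: dist_norm norm_minus_commute)
  moreover have "e * cmod w > 0" using p e by simp
  ultimately show "\<exists>T>0. ball w T \<subseteq> sector d \<alpha>" by blast
qed

lemma open_sector_hat: "open (sector_hat d \<alpha> r)"
  unfolding sector_hat_def by (intro open_Un open_sector open_ball)

lemma zero_in_sector_hat: "r > 0 \<Longrightarrow> 0 \<in> sector_hat d \<alpha> r"
  by (simp add: sector_hat_def)

lemma sector_hat_starlike:
  assumes "w \<in> sector_hat d \<alpha> r" "r > 0"
  shows "closed_segment 0 w \<subseteq> sector_hat d \<alpha> r"
proof
  fix v assume "v \<in> closed_segment 0 w"
  then obtain u where u: "0 \<le> u" "u \<le> 1" "v = of_real u * w"
    by (auto simp: in_segment scaleR_conv_of_real)
  show "v \<in> sector_hat d \<alpha> r"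
  proof (cases "u = 0 \<or> w \<notin> sector d \<alpha>")
    case True
    have "u * cmod w \<le> cmod w" using u by (intro mult_left_le_one_le) auto
    then have "cmod v < r"
      using True u assms by (auto simp: sector_hat_def norm_mult)
    then show ?thesis by (simp add: sector_hat_def)
  next
    case False
    then show ?thesis using sector_scaleR[of w d \<alpha> u] u by (simp add: sector_hat_def)
  qed
qed

section \<open>Continuation with exponential growth\<close>

text \<open>The bound is uniform on the whole set instead of on each smaller one. Since opening and
  radius are existentially quantified in the notion of continuation, halving both shows that nothing
  is lost. Nonnegative constants make the bound monotone in \<open>cmod t\<close>.\<close>

definition sector_exp_fun :: "real \<Rightarrow> real \<Rightarrow> real \<Rightarrow> (complex \<Rightarrow> complex) \<Rightarrow> bool" where
  "sector_exp_fun \<theta> \<alpha> r g \<longleftrightarrow> g holomorphic_on sector_hat \<theta> \<alpha> r \<and>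
     (\<exists>C\<ge>0. \<exists>a\<ge>0. \<forall>t\<in>sector_hat \<theta> \<alpha> r. cmod (g t) \<le> C * exp (a * cmod t))"

lemma sector_exp_funI:
  assumes "g holomorphic_on sector_hat \<theta> \<alpha> r"
    and "\<And>t. t \<in> sector_hat \<theta> \<alpha> r \<Longrightarrow> cmod (g t) \<le> C * exp (a * cmod t)"
  shows "sector_exp_fun \<theta> \<alpha> r g"
proof -
  have "cmod (g t) \<le> \<bar>C\<bar> * exp (\<bar>a\<bar> * cmod t)" if "t \<in> sector_hat \<theta> \<alpha> r" for t
  proof -
    have "C * exp (a * cmod t) \<le> \<bar>C\<bar> * exp (\<bar>a\<bar> * cmod t)"
      by (intro mult_mono) (auto intro: mult_right_mono)
    then show ?thesis using assms(2)[OF that] by linarith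
  qed
  then show ?thesis
    unfolding sector_exp_fun_def using assms(1) by (meson abs_ge_zero)
qed

lemma sector_exp_funE:
  assumes "sector_exp_fun \<theta> \<alpha> r g"
  obtains C a where "C \<ge> 0" "a \<ge> 0" "g holomorphic_on sector_hat \<theta> \<alpha> r"
    "\<And>t. t \<in> sector_hat \<theta> \<alpha> r \<Longrightarrow> cmod (g t) \<le> C * exp (a * cmod t)"
  using assms unfolding sector_exp_fun_def by blast

lemma sector_exp_fun_mono:
  assumes "sector_exp_fun \<theta> \<alpha> r g" "\<alpha>' \<le> \<alpha>" "r' \<le> r"
  shows "sector_exp_fun \<theta> \<alpha>' r' g"
  using assms sector_hat_mono[OF assms(2,3), of \<theta>] holomorphic_on_subset
  unfolding sector_exp_fun_def by (meson subsetD)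

lemma exp_growth_uniform:
  assumes "\<And>t. t \<in> sector_hat d \<alpha> r \<Longrightarrow> N t \<le> C * exp (a * cmod t powr K)"
  shows "exp_growth K d \<alpha> r N"
  unfolding exp_growth_def
proof (intro ballI exI)
  fix \<alpha>' r' t assume "\<alpha>' \<in> {0<..<\<alpha>}" "r' \<in> {0<..<r}" "t \<in> sector_hat d \<alpha>' r'"
  then have "t \<in> sector_hat d \<alpha> r"
    using sector_hat_mono[of \<alpha>' \<alpha> r' r d] by auto
  then show "N t \<le> C * exp (a * cmod t powr K)" by (rule assms)
qed

lemma continues_with_exp_growth_iff:
  "continues_with_exp_growth f 1 \<theta> \<longleftrightarrow>
     (\<exists>\<alpha>>0. \<exists>r>0. \<exists>g. sector_exp_fun \<theta> \<alpha> r g \<and> (\<forall>\<^sub>F z in nhds 0. g z = f z))"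
proof
  assume "continues_with_exp_growth f 1 \<theta>"
  then obtain \<alpha> r g where g: "\<alpha> > 0" "r > 0" "g holomorphic_on sector_hat \<theta> \<alpha> r"
    "\<forall>\<^sub>F z in nhds 0. g z = f z" "exp_growth 1 \<theta> \<alpha> r (\<lambda>t. cmod (g t))"
    unfolding continues_with_exp_growth_def by blast
  then have "\<exists>C a. \<forall>t\<in>sector_hat \<theta> (\<alpha> / 2) (r / 2). cmod (g t) \<le> C * exp (a * cmod t powr 1)"
    unfolding exp_growth_def by simp
  then obtain C a where
    "\<And>t. t \<in> sector_hat \<theta> (\<alpha> / 2) (r / 2) \<Longrightarrow> cmod (g t) \<le> C * exp (a * cmod t)"
    by auto
  moreover have "g holomorphic_on sector_hat \<theta> (\<alpha> / 2) (r / 2)"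
    using g sector_hat_mono[of "\<alpha> / 2" \<alpha> "r / 2" r] by (auto intro: holomorphic_on_subset)
  ultimately have "sector_exp_fun \<theta> (\<alpha> / 2) (r / 2) g" by (rule sector_exp_funI[rotated])
  with g show "\<exists>\<alpha>>0. \<exists>r>0. \<exists>g. sector_exp_fun \<theta> \<alpha> r g \<and> (\<forall>\<^sub>F z in nhds 0. g z = f z)"
    by (meson half_gt_zero)
next
  assume "\<exists>\<alpha>>0. \<exists>r>0. \<exists>g. sector_exp_fun \<theta> \<alpha> r g \<and> (\<forall>\<^sub>F z in nhds 0. g z = f z)"
  then obtain \<alpha> r g where g: "\<alpha> > 0" "r > 0" "sector_exp_fun \<theta> \<alpha> r g" "\<forall>\<^sub>F z in nhds 0. g z = f z"
    by blast
  then obtain C a where "g holomorphic_on sector_hat \<theta> \<alpha> r"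
    "\<And>t. t \<in> sector_hat \<theta> \<alpha> r \<Longrightarrow> cmod (g t) \<le> C * exp (a * cmod t)"
    using sector_exp_funE[OF g(3)] by metis
  then have "exp_growth 1 \<theta> \<alpha> r (\<lambda>t. cmod (g t))"
    by (intro exp_growth_uniform[of _ _ _ _ C a]) auto
  then show "continues_with_exp_growth f 1 \<theta>"
    unfolding continues_with_exp_growth_def using g by (auto simp: sector_exp_fun_def)
qed

text \<open>Cauchy's inequality on discs of one fixed radius \<open>e\<close>: moving the argument
  by \<open>e\<close> costs the factor \<open>exp (a * e)\<close>, and differentiating costs
  1/\<open>e\<close>.\<close>

lemma sector_exp_fun_deriv:
  assumes "sector_exp_fun \<theta> \<alpha> r g" "\<alpha>' < \<alpha>" "0 < r'" "r' < r"
  shows "sector_exp_fun \<theta> \<alpha>' r' (deriv g)"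
proof -
  obtain C a where g: "C \<ge> 0" "a \<ge> 0" "g holomorphic_on sector_hat \<theta> \<alpha> r"
    and le: "\<And>t. t \<in> sector_hat \<theta> \<alpha> r \<Longrightarrow> cmod (g t) \<le> C * exp (a * cmod t)"
    using sector_exp_funE[OF assms(1)] by metis
  obtain e where e: "0 < e" "\<And>w. w \<in> sector_hat \<theta> \<alpha>' r' \<Longrightarrow> cball w e \<subseteq> sector_hat \<theta> \<alpha> r"
    using sector_hat_cball_subset[OF assms(2-4)] by metis
  show ?thesis
  proof (rule sector_exp_funI)
    show "deriv g holomorphic_on sector_hat \<theta> \<alpha>' r'"
      using holomorphic_deriv[OF g(3) open_sector_hat] sector_hat_mono[of \<alpha>' \<alpha> r' r] assms
      by (auto intro: holomorphic_on_subset)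
    fix w assume w: "w \<in> sector_hat \<theta> \<alpha>' r'"
    have hol: "g holomorphic_on cball w e"
      using e(2)[OF w] g(3) by (rule holomorphic_on_subset[rotated])
    have "cmod ((deriv ^^ 1) g w) \<le> fact 1 * (C * exp (a * (cmod w + e))) / e ^ 1"
    proof (rule Cauchy_inequality)
      show "g holomorphic_on ball w e" using hol by (rule holomorphic_on_subset) auto
      show "continuous_on (cball w e) g" using hol by (rule holomorphic_on_imp_continuous_on)
      fix x assume x: "cmod (w - x) = e"
      then have "x \<in> sector_hat \<theta> \<alpha> r" using e(2)[OF w] by (auto simp: dist_norm)
      then have "cmod (g x) \<le> C * exp (a * cmod x)" by (rule le)
      also have "cmod x \<le> cmod w + e"
        using norm_triangle_ineq4[of w "w - x"] x by simp
      finally show "cmod (g x) \<le> C * exp (a * (cmod w + e))"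
        using g(1,2) by (simp add: mult_left_mono)
    qed (rule e)
    then show "cmod (deriv g w) \<le> (C * exp (a * e) / e) * exp (a * cmod w)"
      by (simp add: exp_add distrib_left mult_ac)
  qed
qed

lemma sector_exp_fun_higher_deriv:
  assumes "sector_exp_fun \<theta> \<alpha> r g" "\<alpha>' < \<alpha>" "0 < r'" "r' < r"
  shows "sector_exp_fun \<theta> \<alpha>' r' ((deriv ^^ n) g)"
  using assms(2-4)
proof (induction n arbitrary: \<alpha>' r')
  case 0
  then show ?case using sector_exp_fun_mono[OF assms(1)] by simp
next
  case (Suc n)
  \<comment> \<open>Each differentiation gives up some opening and radius; intermediate values leave
    enough for the remaining ones.\<close>
  obtain \<beta> where b: "\<alpha>' < \<beta>" "\<beta> < \<alpha>" using dense Suc.prems by blast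
  obtain s where s: "r' < s" "s < r" using dense Suc.prems by blast
  have "sector_exp_fun \<theta> \<beta> s ((deriv ^^ n) g)" using Suc b s by auto
  then show ?case using b s Suc.prems by (auto intro: sector_exp_fun_deriv)
qed

lemma sector_exp_fun_add:
  assumes "sector_exp_fun \<theta> \<alpha> r g" "sector_exp_fun \<theta> \<alpha> r h"
  shows "sector_exp_fun \<theta> \<alpha> r (\<lambda>t. g t + h t)"
proof -
  obtain C a where g: "C \<ge> 0" "a \<ge> 0" "g holomorphic_on sector_hat \<theta> \<alpha> r"
    "\<And>t. t \<in> sector_hat \<theta> \<alpha> r \<Longrightarrow> cmod (g t) \<le> C * exp (a * cmod t)"
    using sector_exp_funE[OF assms(1)] by metis
  obtain D b where h: "D \<ge> 0" "b \<ge> 0" "h holomorphic_on sector_hat \<theta> \<alpha> r"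
    "\<And>t. t \<in> sector_hat \<theta> \<alpha> r \<Longrightarrow> cmod (h t) \<le> D * exp (b * cmod t)"
    using sector_exp_funE[OF assms(2)] by metis
  show ?thesis
  proof (rule sector_exp_funI)
    fix t assume t: "t \<in> sector_hat \<theta> \<alpha> r"
    have "cmod (g t + h t) \<le> C * exp (a * cmod t) + D * exp (b * cmod t)"
      using g(4)[OF t] h(4)[OF t] norm_triangle_ineq[of "g t" "h t"] by linarith
    also have "\<dots> \<le> C * exp (max a b * cmod t) + D * exp (max a b * cmod t)"
      using g(1) h(1) by (intro add_mono mult_left_mono) (auto intro!: mult_right_mono)
    finally show "cmod (g t + h t) \<le> (C + D) * exp (max a b * cmod t)"
      by (simp add: distrib_right)
  qed (intro holomorphic_intros g h)
qed

lemma sector_exp_fun_cmult: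
  assumes "sector_exp_fun \<theta> \<alpha> r g"
  shows "sector_exp_fun \<theta> \<alpha> r (\<lambda>t. c * g t)"
proof -
  obtain C a where g: "C \<ge> 0" "a \<ge> 0" "g holomorphic_on sector_hat \<theta> \<alpha> r"
    "\<And>t. t \<in> sector_hat \<theta> \<alpha> r \<Longrightarrow> cmod (g t) \<le> C * exp (a * cmod t)"
    using sector_exp_funE[OF assms(1)] by metis
  show ?thesis
  proof (rule sector_exp_funI)
    fix t assume t: "t \<in> sector_hat \<theta> \<alpha> r"
    show "cmod (c * g t) \<le> (cmod c * C) * exp (a * cmod t)"
      using mult_left_mono[OF g(4)[OF t] norm_ge_zero[of c]] by (simp add: norm_mult mult_ac)
  qed (intro holomorphic_intros g)
qed

text \<open>The set is starlike about 0, which yields a primitive and allows integration along the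
  segment from 0. The length \<open>cmod t\<close> of the segment is absorbed by raising the rate
  from \<open>a\<close> to \<open>a + 1\<close>.\<close>

lemma sector_exp_fun_primitive:
  assumes "sector_exp_fun \<theta> \<alpha> r g" "r > 0"
  shows "\<exists>G. sector_exp_fun \<theta> \<alpha> r G \<and> G 0 = 0 \<and>
    (\<forall>t\<in>sector_hat \<theta> \<alpha> r. (G has_field_derivative g t) (at t))"
proof -
  let ?S = "sector_hat \<theta> \<alpha> r"
  obtain C a where g: "C \<ge> 0" "a \<ge> 0" "g holomorphic_on ?S"
    and le: "\<And>t. t \<in> ?S \<Longrightarrow> cmod (g t) \<le> C * exp (a * cmod t)"
    using sector_exp_funE[OF assms(1)] by metis
  have "starlike ?S"
    unfolding starlike_def using assms(2) zero_in_sector_hat sector_hat_starlike by blast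
  moreover have "g field_differentiable at x" if "x \<in> ?S" for x
    using g(3) open_sector_hat that by (rule holomorphic_on_imp_differentiable_at)
  ultimately have "\<exists>H. \<forall>x\<in>?S. (H has_field_derivative g x) (at x)"
    using g(3) by (intro holomorphic_starlike_primitive[of _ _ "{}"])
      (auto intro: holomorphic_on_imp_continuous_on open_sector_hat)
  then obtain H where H: "\<And>x. x \<in> ?S \<Longrightarrow> (H has_field_derivative g x) (at x)" by blast
  define G where "G = (\<lambda>t. H t - H 0)"
  have G: "(G has_field_derivative g x) (at x)" if "x \<in> ?S" for x
    unfolding G_def using H[OF that] by (auto intro!: derivative_eq_intros)
  show ?thesis
  proof (intro exI conjI ballI)
    show "sector_exp_fun \<theta> \<alpha> r G"
    proof (rule sector_exp_funI)
      show "G holomorphic_on ?S"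
        using G by (auto simp: holomorphic_on_open open_sector_hat)
      fix t assume t: "t \<in> ?S"
      have le_exp: "cmod t \<le> exp (cmod t)"
        using exp_ge_add_one_self[of "cmod t"] by linarith
      have seg: "closed_segment 0 t \<subseteq> ?S" using sector_hat_starlike[OF t assms(2)] .
      have "cmod (G t - G 0) \<le> (C * exp (a * cmod t)) * cmod (t - 0)"
      proof (rule field_differentiable_bound[where S = "closed_segment 0 t" and f' = g])
        fix z assume z: "z \<in> closed_segment 0 t"
        then show "(G has_field_derivative g z) (at z within closed_segment 0 t)"
          using seg G by (blast intro: has_field_derivative_at_within)
        have "cmod (g z) \<le> C * exp (a * cmod z)" using z seg le by blast
        also have "\<dots> \<le> C * exp (a * cmod t)"
        proof -
          have "cmod z \<le> cmod t" using segment_bound1[OF z] by simp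
          then show ?thesis using g(1,2) by (intro mult_left_mono) (auto intro: mult_left_mono)
        qed
        finally show "cmod (g z) \<le> C * exp (a * cmod t)" .
      qed auto
      also have "\<dots> \<le> C * exp (a * cmod t) * exp (cmod t)"
        using g(1) le_exp by (intro mult_left_mono) auto
      finally show "cmod (G t) \<le> C * exp ((a + 1) * cmod t)"
        by (simp add: G_def mult.assoc exp_add[symmetric] algebra_simps)
    qed
    show "G 0 = 0" by (simp add: G_def)
  qed (rule G)
qed

text \<open>The germ is encoded by its Taylor series, so that shifts, scalings and sums can be
  checked on coefficients without choosing representatives.\<close>

definition fps_continues :: "real \<Rightarrow> complex fps \<Rightarrow> bool" where
  "fps_continues \<theta> F \<longleftrightarrow> (\<exists>\<alpha>>0. \<exists>r>0. \<exists>g. sector_exp_fun \<theta> \<alpha> r g \<and> g has_fps_expansion F)"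

lemma continues_iff_fps_continues:
  assumes "f has_fps_expansion F"
  shows "continues_with_exp_growth f 1 \<theta> \<longleftrightarrow> fps_continues \<theta> F"
proof -
  have "(\<forall>\<^sub>F z in nhds 0. g z = f z) \<longleftrightarrow> g has_fps_expansion F" for g
  proof
    assume "\<forall>\<^sub>F z in nhds 0. g z = f z"
    then show "g has_fps_expansion F"
      using has_fps_expansion_cong[OF _ refl, of g f F] assms by simp
  next
    assume "g has_fps_expansion F"
    then have "\<forall>\<^sub>F z in nhds 0. eval_fps F z = g z" "\<forall>\<^sub>F z in nhds 0. eval_fps F z = f z"
      using assms by (auto simp: has_fps_expansion_def)
    then show "\<forall>\<^sub>F z in nhds 0. g z = f z" by eventually_elim simp
  qed
  then show ?thesis
    by (simp add: continues_with_exp_growth_iff fps_continues_def)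
qed

lemma fps_continues_add:
  assumes "fps_continues \<theta> F" "fps_continues \<theta> G"
  shows "fps_continues \<theta> (F + G)"
proof -
  obtain \<alpha> r g where g: "\<alpha> > 0" "r > 0" "sector_exp_fun \<theta> \<alpha> r g" "g has_fps_expansion F"
    using assms(1) unfolding fps_continues_def by blast
  obtain \<beta> s h where h: "\<beta> > 0" "s > 0" "sector_exp_fun \<theta> \<beta> s h" "h has_fps_expansion G"
    using assms(2) unfolding fps_continues_def by blast
  have "sector_exp_fun \<theta> (min \<alpha> \<beta>) (min r s) (\<lambda>t. g t + h t)"
    using g h by (intro sector_exp_fun_add) (auto elim: sector_exp_fun_mono)
  moreover have "(\<lambda>t. g t + h t) has_fps_expansion F + G"
    using g h by (intro has_fps_expansion_add)
  ultimately show ?thesis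
    unfolding fps_continues_def using g(1,2) h(1,2)
    by (intro exI[of _ "min \<alpha> \<beta>"] exI[of _ "min r s"] conjI exI) auto
qed

lemma fps_continues_cmult:
  assumes "fps_continues \<theta> F"
  shows "fps_continues \<theta> (fps_const c * F)"
proof -
  obtain \<alpha> r g where g: "\<alpha> > 0" "r > 0" "sector_exp_fun \<theta> \<alpha> r g" "g has_fps_expansion F"
    using assms unfolding fps_continues_def by blast
  then show ?thesis
    unfolding fps_continues_def
    using sector_exp_fun_cmult[OF g(3), of c] has_fps_expansion_cmult_left[OF g(4), of c] by blast
qed

lemma fps_continues_0: "fps_continues \<theta> 0"
proof -
  have "sector_exp_fun \<theta> 1 1 (\<lambda>_. 0)"
    by (rule sector_exp_funI[of _ _ _ _ 0 0]) auto
  then show ?thesis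
    unfolding fps_continues_def using has_fps_expansion_0 zero_less_one by blast
qed

lemma fps_continues_sum:
  assumes "finite A" "\<And>x. x \<in> A \<Longrightarrow> fps_continues \<theta> (F x)"
  shows "fps_continues \<theta> (\<Sum>x\<in>A. F x)"
  using assms by (induction rule: finite_induct) (auto intro: fps_continues_0 fps_continues_add)

text \<open>The primitive vanishing at 0 has some expansion; differentiating it gives back
  \<open>F\<close>, and the zero constant term then identifies it with
  \<open>fps_integral0 F\<close>.\<close>

lemma fps_continues_integral:
  assumes "fps_continues \<theta> F"
  shows "fps_continues \<theta> (fps_integral0 F)"
proof -
  obtain \<alpha> r g where g: "\<alpha> > 0" "r > 0" "sector_exp_fun \<theta> \<alpha> r g" "g has_fps_expansion F"
    using assms unfolding fps_continues_def by blast
  obtain G where G: "sector_exp_fun \<theta> \<alpha> r G" "G 0 = 0"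
    "\<forall>t\<in>sector_hat \<theta> \<alpha> r. (G has_field_derivative g t) (at t)"
    using sector_exp_fun_primitive[OF g(3,2)] by blast
  define H where "H = fps_expansion G 0"
  have H: "G has_fps_expansion H"
  proof -
    have "G holomorphic_on sector_hat \<theta> \<alpha> r"
      using G(1) by (simp add: sector_exp_fun_def)
    then have "G analytic_on {0}"
      unfolding analytic_at using open_sector_hat zero_in_sector_hat[OF g(2)]
      by (intro exI[of _ "sector_hat \<theta> \<alpha> r"] conjI)
    then show ?thesis
      unfolding H_def by (rule analytic_at_imp_has_fps_expansion_0)
  qed
  have "deriv G has_fps_expansion fps_deriv H"
    using H by (rule has_fps_expansion_deriv)
  moreover have "\<forall>\<^sub>F t in nhds 0. deriv G t = g t"
    using eventually_nhds_in_open[OF open_sector_hat zero_in_sector_hat[OF g(2)]]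
    by eventually_elim (rule DERIV_imp_deriv, use G(3) in blast)
  ultimately have "g has_fps_expansion fps_deriv H"
    using has_fps_expansion_cong[OF _ refl] by blast
  then have "fps_deriv H = F"
    using g(4) fps_expansion_unique_complex by blast
  moreover have "H $ 0 = 0" using G(2) H has_fps_expansion_imp_0_eq_fps_nth_0 by metis
  ultimately have "H = fps_integral0 F"
    using fps_integral0_deriv[of H] by simp
  then show ?thesis
    unfolding fps_continues_def using g(1,2) H G(1) by blast
qed

text \<open>Substitution of \<open>a * t\<close> for \<open>t\<close>: multiplication by
  \<open>a\<close> turns the new sector into the old one, and the disc shrinks by
  \<open>cmod a\<close>.\<close>

lemma fps_continues_scale:
  assumes "fps_continues \<theta> F" "a \<noteq> 0"
  shows "fps_continues (\<theta> - Arg a) (Abs_fps (\<lambda>n. a ^ n * F $ n))"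
proof -
  obtain \<alpha> r g where g: "\<alpha> > 0" "r > 0" "sector_exp_fun \<theta> \<alpha> r g" "g has_fps_expansion F"
    using assms unfolding fps_continues_def by blast
  obtain C b where h: "C \<ge> 0" "b \<ge> 0" "g holomorphic_on sector_hat \<theta> \<alpha> r"
    "\<And>t. t \<in> sector_hat \<theta> \<alpha> r \<Longrightarrow> cmod (g t) \<le> C * exp (b * cmod t)"
    using sector_exp_funE[OF g(3)] by metis
  have mem: "a * t \<in> sector_hat \<theta> \<alpha> r"
    if "t \<in> sector_hat (\<theta> - Arg a) \<alpha> (r / cmod a)" for t
    using that sector_mult[of t "\<theta> - Arg a" \<alpha> a] assms(2)
    by (auto simp: sector_hat_def norm_mult field_simps)
  have "sector_exp_fun (\<theta> - Arg a) \<alpha> (r / cmod a) (\<lambda>t. g (a * t))"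
  proof (rule sector_exp_funI)
    have "g \<circ> (\<lambda>t. a * t) holomorphic_on sector_hat (\<theta> - Arg a) \<alpha> (r / cmod a)"
      using mem by (intro holomorphic_on_compose_gen[OF _ h(3)] holomorphic_intros) auto
    then show "(\<lambda>t. g (a * t)) holomorphic_on sector_hat (\<theta> - Arg a) \<alpha> (r / cmod a)"
      by (simp add: o_def)
    fix t assume "t \<in> sector_hat (\<theta> - Arg a) \<alpha> (r / cmod a)"
    from h(4)[OF mem[OF this]] show "cmod (g (a * t)) \<le> C * exp ((b * cmod a) * cmod t)"
      by (simp add: norm_mult mult_ac)
  qed
  moreover have "(\<lambda>t. g (a * t)) has_fps_expansion Abs_fps (\<lambda>n. a ^ n * F $ n)"
  proof (rule has_fps_expansionI)
    have "\<forall>\<^sub>F t in nhds 0. t \<in> ball 0 (r / cmod a)"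
      using g(2) assms(2) by (intro eventually_nhds_in_open) auto
    then show "\<forall>\<^sub>F t in nhds 0. (\<lambda>n. Abs_fps (\<lambda>n. a ^ n * F $ n) $ n * t ^ n) sums g (a * t)"
    proof eventually_elim
      case (elim t)
      have "(\<lambda>n. F $ n * (a * t) ^ n) sums g (a * t)"
      proof (rule has_fps_expansion_imp_sums_complex[OF g(4)])
        show "g holomorphic_on eball 0 (ereal r)"
          using h(3) by (rule holomorphic_on_subset) (auto simp: sector_hat_def eball_def)
        show "ereal (cmod (a * t)) < ereal r"
          using elim assms(2) by (simp add: norm_mult field_simps)
      qed
      then show ?case by (simp add: power_mult_distrib mult_ac)
    qed
  qed
  ultimately show ?thesis
    unfolding fps_continues_def using g(1,2) assms(2)
    by (intro exI[of _ \<alpha>] exI[of _ "r / cmod a"] conjI exI) auto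
qed

section \<open>Coefficients of the formal solution\<close>

lemma eps_deriv_funpow:
  "(eps_deriv k ^^ j) x n = (if n < k * j then (\<lambda>_. 0) else (deriv ^^ j) (x (n - k * j)))"
proof (induction j arbitrary: n)
  case (Suc j)
  have "deriv (\<lambda>_::complex. 0 :: complex) = (\<lambda>_. 0)" by (rule ext) simp
  moreover have "(eps_deriv k ^^ Suc j) x n
      = (if n < k then (\<lambda>_. 0) else deriv ((eps_deriv k ^^ j) x (n - k)))"
    by (simp add: eps_deriv_def)
  ultimately show ?case
    by (auto simp: Suc.IH less_diff_conv2 diff_diff_left add.commute)
qed auto

lemma fps_mult_inverse_coeff:
  fixes F :: "'a::field fps"
  assumes "F $ 0 \<noteq> 0"
  shows "(\<Sum>j\<le>m. F $ j * inverse F $ (m - j)) = (if m = 0 then 1 else 0)"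
proof -
  have "(F * inverse F) $ m = (\<Sum>j\<le>m. F $ j * inverse F $ (m - j))"
    by (simp add: fps_mult_nth atLeast0AtMost)
  moreover have "F * inverse F = 1" using inverse_mult_eq_1'[OF assms] .
  ultimately show ?thesis by (metis fps_one_nth)
qed

text \<open>Because P(0) is nonzero, the coefficient of order \<open>n\<close> in the equation
  determines \<open>x n\<close> from earlier coefficients. With the formula inserted for these, the
  derivative of \<open>f\<close> factors out and the identity P * (1/P) = 1 remains.\<close>

lemma formal_solution_coeff:
  assumes k: "k \<ge> 1" and P: "poly P 0 \<noteq> 0" and f: "f holomorphic_on ball 0 r"
    and x: "formal_solution r P k f x" and z: "z \<in> ball 0 r"
  shows "x n z = (if k dvd n
    then inverse (fps_of_poly P) $ (n div k) * (deriv ^^ (n div k)) f z else 0)"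
  using z
proof (induction n arbitrary: z rule: less_induct)
  case (less n)
  define c where "c = inverse (fps_of_poly P)"
  define F where "F = (\<lambda>n z. if k dvd n then c $ (n div k) * (deriv ^^ (n div k)) f z else 0)"
  define m where "m = n div k"
  have P0: "coeff P 0 \<noteq> 0" using P by (simp add: poly_0_coeff_0)
  have xd: "x i holomorphic_on ball 0 r" for i
    using x by (auto simp: formal_solution_def disc_space_def)
  have Fd: "F i holomorphic_on ball 0 r" for i
    by (cases "k dvd i") (auto simp: F_def intro!: holomorphic_intros holomorphic_higher_deriv f)
  have IH: "x i w = F i w" if "i < n" "w \<in> ball 0 r" for i w
    using less.IH[OF that] by (simp add: F_def c_def)
  \<comment> \<open>Every term with j \<ge> 1 carries the same derivative of order \<open>m\<close>:
    j derivatives act on a coefficient that already contains \<open>m - j\<close> of them.\<close>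
  have T: "(deriv ^^ j) (x (n - k * j)) z = (if k dvd n then c $ (m - j) * (deriv ^^ m) f z else 0)"
    if j: "j \<ge> 1" "k * j \<le> n" for j
  proof -
    have lt: "n - k * j < n"
    proof -
      have "k * j \<ge> 1" using k j(1) by simp
      then show ?thesis using j(2) by linarith
    qed
    have "(deriv ^^ j) (x (n - k * j)) z = (deriv ^^ j) (F (n - k * j)) z"
      using IH[OF lt] by (intro higher_deriv_transform_within_open[OF xd Fd _ less.prems]) auto
    also have "\<dots> = (if k dvd n then c $ (m - j) * (deriv ^^ m) f z else 0)"
    proof (cases "k dvd n")
      case True
      then have n: "n = k * m" by (simp add: m_def)
      have jm: "j \<le> m" using j(2) k n by simp
      have nm: "n - k * j = k * (m - j)" by (simp add: n diff_mult_distrib2)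
      have "F (n - k * j) = (\<lambda>z. c $ (m - j) * (deriv ^^ (m - j)) f z)"
        unfolding F_def nm using k by simp
      then have "(deriv ^^ j) (F (n - k * j)) z = c $ (m - j) * (deriv ^^ j) ((deriv ^^ (m - j)) f) z"
        using less.prems by (simp add: higher_deriv_cmult[OF holomorphic_higher_deriv[OF f]])
      also have "(deriv ^^ j) ((deriv ^^ (m - j)) f) = (deriv ^^ m) f"
        using jm by (metis funpow_add o_apply le_add_diff_inverse)
      finally show ?thesis using True by simp
    next
      case False
      then have "\<not> k dvd n - k * j" using j(2) by (metis dvd_diffD dvd_triv_left)
      then have "F (n - k * j) = (\<lambda>_. 0)" by (simp add: F_def)
      then show ?thesis using False by simp
    qed
    finally show ?thesis .
  qed
  \<comment> \<open>Prepares the change of range from \<open>degree P\<close> to \<open>m\<close>,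
    the range of a Cauchy product: for j > m the shifted index is negative, for j >
    \<open>degree P\<close> the coefficient of P is 0. The unknown \<open>x n z\<close> is kept at j
    = 0.\<close>
  define S where "S j = (if j = 0 then x n z else if k dvd n then c $ (m - j) * (deriv ^^ m) f z else 0)" for j
  have "(\<Sum>j\<le>degree P. coeff P j * (eps_deriv k ^^ j) x n z) = (if n = 0 then f z else 0)"
    using x less.prems unfolding formal_solution_def poly_eps_deriv_def by blast
  moreover have "(\<Sum>j\<le>degree P. coeff P j * (eps_deriv k ^^ j) x n z) = (\<Sum>j\<le>m. coeff P j * S j)"
  proof (rule sum.mono_neutral_cong)
    fix j assume "j \<in> {..degree P} - {..m}"
    then have "n < k * j"
      using k by (auto simp: m_def div_less_iff_less_mult mult.commute not_le)
    then show "coeff P j * (eps_deriv k ^^ j) x n z = 0" by (simp add: eps_deriv_funpow)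
  next
    fix j assume "j \<in> {..m} - {..degree P}"
    then show "coeff P j * S j = 0" by (simp add: coeff_eq_0)
  next
    fix j assume "j \<in> {..degree P} \<inter> {..m}"
    then have "j \<le> n div k" by (simp add: m_def)
    then have "k * j \<le> n" using k
      by (metis less_eq_div_iff_mult_less_eq mult.commute less_le_trans zero_less_one)
    then show "coeff P j * (eps_deriv k ^^ j) x n z = coeff P j * S j"
      using T[of j] by (cases "j = 0") (auto simp: eps_deriv_funpow S_def)
  qed auto
  ultimately have eq: "(\<Sum>j\<le>m. coeff P j * S j) = (if n = 0 then f z else 0)" by simp
  have split: "(\<Sum>j\<le>m. coeff P j * S j) = coeff P 0 * x n z + (\<Sum>j\<in>{..m} - {0}. coeff P j * S j)"
    by (subst sum.remove[of _ 0]) (auto simp: S_def)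
  have "x n z = F n z"
  proof (cases "k dvd n")
    case True
    then have n: "n = k * m" by (simp add: m_def)
    \<comment> \<open>The recursion for the coefficients of 1/P has the same shape as the one for
      \<open>x n z\<close>, so the two can be compared term by term.\<close>
    have "(\<Sum>j\<le>m. coeff P j * c $ (m - j)) = (if m = 0 then 1 else 0)"
      using fps_mult_inverse_coeff[of "fps_of_poly P" m] P0 by (simp add: c_def)
    moreover have "(\<Sum>j\<le>m. coeff P j * c $ (m - j))
        = coeff P 0 * c $ m + (\<Sum>j\<in>{..m} - {0}. coeff P j * c $ (m - j))"
      by (subst sum.remove[of _ 0]) auto
    ultimately have *: "coeff P 0 * c $ m
        = (if m = 0 then 1 else 0) - (\<Sum>j\<in>{..m} - {0}. coeff P j * c $ (m - j))"
      by (simp add: algebra_simps)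
    have "(\<Sum>j\<in>{..m} - {0}. coeff P j * S j)
        = (\<Sum>j\<in>{..m} - {0}. coeff P j * c $ (m - j)) * (deriv ^^ m) f z"
      unfolding sum_distrib_right by (rule sum.cong) (auto simp: S_def True)
    then have "coeff P 0 * x n z = (if m = 0 then f z else 0)
        - (\<Sum>j\<in>{..m} - {0}. coeff P j * c $ (m - j)) * (deriv ^^ m) f z"
      using eq split n k by (simp add: algebra_simps)
    also have "\<dots> = coeff P 0 * c $ m * (deriv ^^ m) f z"
      unfolding * by (simp add: algebra_simps)
    finally show ?thesis using P0 True by (simp add: F_def m_def mult.assoc)
  next
    case False
    then have "n \<noteq> 0" by (metis dvd_0_right)
    moreover have "(\<Sum>j\<in>{..m} - {0}. coeff P j * S j) = 0"
      by (rule sum.neutral) (auto simp: S_def False)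
    ultimately have "coeff P 0 * x n z = 0" using eq split by simp
    then show ?thesis using P0 False by (simp add: F_def)
  qed
  then show ?case by (simp add: F_def c_def)
qed

section \<open>The space of disc functions\<close>

lemma disc_norm_upper:
  assumes "\<phi> \<in> disc_space r" "z \<in> cball 0 r"
  shows "cmod (\<phi> z) \<le> disc_norm r \<phi>"
proof -
  have "compact ((\<lambda>z. cmod (\<phi> z)) ` cball 0 r)"
    using assms(1) by (intro compact_continuous_image continuous_intros) (auto simp: disc_space_def)
  then have "bdd_above ((\<lambda>z. cmod (\<phi> z)) ` cball 0 r)"
    by (intro bounded_imp_bdd_above compact_imp_bounded)
  then show ?thesis unfolding disc_norm_def using assms(2) by (rule cSUP_upper2) auto
qed

lemma disc_norm_least:
  assumes "r \<ge> 0" "\<And>z. z \<in> cball 0 r \<Longrightarrow> cmod (\<phi> z) \<le> B"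
  shows "disc_norm r \<phi> \<le> B"
  unfolding disc_norm_def using assms by (intro cSUP_least) auto

lemma disc_norm_nonneg:
  assumes "\<phi> \<in> disc_space r" "r \<ge> 0"
  shows "disc_norm r \<phi> \<ge> 0"
  by (rule order_trans[OF norm_ge_zero disc_norm_upper[OF assms(1), of 0]]) (use assms(2) in auto)

lemma disc_space_diff:
  "\<phi> \<in> disc_space r \<Longrightarrow> \<psi> \<in> disc_space r \<Longrightarrow> (\<lambda>z. \<phi> z - \<psi> z) \<in> disc_space r"
  by (auto simp: disc_space_def intro!: holomorphic_intros continuous_intros)

lemma disc_space_cmult: "\<phi> \<in> disc_space r \<Longrightarrow> (\<lambda>z. c * \<phi> z) \<in> disc_space r"
  by (auto simp: disc_space_def intro!: holomorphic_intros continuous_intros)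

lemma disc_space_sum:
  "(\<And>n. n \<in> A \<Longrightarrow> u n \<in> disc_space r) \<Longrightarrow> (\<lambda>z. \<Sum>n\<in>A. u n z) \<in> disc_space r"
  by (auto simp: disc_space_def intro!: holomorphic_intros continuous_intros)

text \<open>Derivatives at the centre are bounded linear functionals on the Banach space. They carry
  norm convergence, norm holomorphy and growth over to scalar functions.\<close>

lemma disc_space_higher_deriv_bound:
  assumes "\<phi> \<in> disc_space r" "r > 0"
  shows "cmod ((deriv ^^ j) \<phi> 0) \<le> fact j / r ^ j * disc_norm r \<phi>"
proof -
  have "cmod ((deriv ^^ j) \<phi> 0) \<le> fact j * disc_norm r \<phi> / r ^ j"
    using assms disc_norm_upper[OF assms(1)]
    by (intro Cauchy_inequality) (auto simp: disc_space_def)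
  then show ?thesis by simp
qed

lemma higher_deriv_sum:
  assumes "finite A" "\<And>n. n \<in> A \<Longrightarrow> u n holomorphic_on S" "open S" "z \<in> S"
  shows "(deriv ^^ j) (\<lambda>w. \<Sum>n\<in>A. u n w) z = (\<Sum>n\<in>A. (deriv ^^ j) (u n) z)"
  using assms(1,2)
proof (induction rule: finite_induct)
  case (insert a A)
  then show ?case
    using assms(3,4) by (simp add: higher_deriv_add[where S = S] holomorphic_on_sum)
qed auto

lemma disc_sums_higher_deriv:
  assumes "disc_sums r u \<phi>" "\<And>n. u n \<in> disc_space r" "r > 0"
  shows "(\<lambda>n. (deriv ^^ j) (u n) 0) sums (deriv ^^ j) \<phi> 0"
proof -
  have \<phi>: "\<phi> \<in> disc_space r"
    and lim: "(\<lambda>N. disc_norm r (\<lambda>z. (\<Sum>n<N. u n z) - \<phi> z)) \<longlonglongrightarrow> 0"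
    using assms(1) by (auto simp: disc_sums_def)
  let ?e = "\<lambda>N z. (\<Sum>n<N. u n z) - \<phi> z"
  have e: "?e N \<in> disc_space r" for N
    using assms(2) \<phi> by (intro disc_space_diff disc_space_sum)
  have hol: "u n holomorphic_on ball 0 r" "\<phi> holomorphic_on ball 0 r" for n
    using assms(2) \<phi> by (auto simp: disc_space_def)
  have eq: "(deriv ^^ j) (?e N) 0 = (\<Sum>n<N. (deriv ^^ j) (u n) 0) - (deriv ^^ j) \<phi> 0" for N
    using assms(3) hol
    by (subst higher_deriv_diff[where S = "ball 0 r"])
      (auto simp: higher_deriv_sum[where S = "ball 0 r"] intro!: holomorphic_intros)
  have "(\<lambda>N. fact j / r ^ j * disc_norm r (?e N)) \<longlonglongrightarrow> 0"
    using tendsto_mult_right_zero[OF lim] .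
  then have "(\<lambda>N. (deriv ^^ j) (?e N) 0) \<longlonglongrightarrow> 0"
    by (rule Lim_null_comparison[rotated])
      (use disc_space_higher_deriv_bound[OF e assms(3)] in auto)
  then show ?thesis unfolding sums_def eq by (simp add: LIM_zero_iff)
qed

lemma disc_holomorphic_higher_deriv:
  assumes "disc_holomorphic_on r G \<Omega>" "open \<Omega>" "r > 0"
  shows "(\<lambda>t. (deriv ^^ j) (G t) 0) holomorphic_on \<Omega>"
  unfolding holomorphic_on_open[OF assms(2)]
proof (intro ballI)
  fix t assume t: "t \<in> \<Omega>"
  let ?L = "\<lambda>\<phi>. (deriv ^^ j) \<phi> (0::complex)"
  obtain D where D: "D \<in> disc_space r"
    and lim: "((\<lambda>h. disc_norm r (\<lambda>z. (G (t + h) z - G t z) / h - D z)) \<longlongrightarrow> 0) (at 0)"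
    using assms(1) t unfolding disc_holomorphic_on_def by blast
  have G: "G s \<in> disc_space r" if "s \<in> \<Omega>" for s
    using assms(1) that unfolding disc_holomorphic_on_def by blast
  let ?e = "\<lambda>h z. (G (t + h) z - G t z) / h - D z"
  have "((\<lambda>h. fact j / r ^ j * disc_norm r (?e h)) \<longlongrightarrow> 0) (at 0)"
    using tendsto_mult_right_zero[OF lim] .
  moreover have "\<forall>\<^sub>F h in at 0. cmod ((?L (G (t + h)) - ?L (G t)) / h - ?L D)
      \<le> fact j / r ^ j * disc_norm r (?e h)"
  proof -
    have "\<forall>\<^sub>F h in at 0. t + h \<in> \<Omega>"
    proof -
      have "((\<lambda>h. t + h) \<longlongrightarrow> t) (at 0)" by (auto intro!: tendsto_eq_intros)
      then show ?thesis using assms(2) t by (rule topological_tendstoD)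
    qed
    then show ?thesis
    proof eventually_elim
      case (elim h)
      have e: "?e h = (\<lambda>z. (1 / h) * (G (t + h) z - G t z) - D z)"
        by (simp add: divide_inverse mult.commute)
      have d: "?e h \<in> disc_space r"
        unfolding e using G[OF elim] G[OF t] D by (intro disc_space_diff disc_space_cmult)
      have "G (t + h) holomorphic_on ball 0 r" "G t holomorphic_on ball 0 r" "D holomorphic_on ball 0 r"
        using G[OF elim] G[OF t] D by (auto simp: disc_space_def)
      then have "?L (?e h) = ?L (\<lambda>z. (1 / h) * (G (t + h) z - G t z)) - ?L D"
        "?L (\<lambda>z. (1 / h) * (G (t + h) z - G t z)) = (1 / h) * ?L (\<lambda>z. G (t + h) z - G t z)"
        "?L (\<lambda>z. G (t + h) z - G t z) = ?L (G (t + h)) - ?L (G t)"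
        unfolding e using assms(3)
        by (intro higher_deriv_diff[where S = "ball 0 r"] higher_deriv_cmult[where A = "ball 0 r"]
            holomorphic_intros; simp)+
      then have "?L (?e h) = (1 / h) * (?L (G (t + h)) - ?L (G t)) - ?L D"
        by simp
      then show ?case
        using disc_space_higher_deriv_bound[OF d assms(3), of j] by simp
    qed
  qed
  ultimately have "((\<lambda>h. (?L (G (t + h)) - ?L (G t)) / h - ?L D) \<longlongrightarrow> 0) (at 0)"
    by (rule Lim_null_comparison[rotated])
  then have "((\<lambda>h. (?L (G (t + h)) - ?L (G t)) / h) \<longlongrightarrow> ?L D) (at 0)"
    by (simp add: LIM_zero_iff)
  then show "\<exists>f'. ((\<lambda>t. ?L (G t)) has_field_derivative f') (at t)"
    unfolding DERIV_def by blast
qed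

section \<open>From summability to continuation\<close>

lemma complex_root_exists:
  assumes "k \<ge> 1"
  obtains t :: complex where "t ^ k = s"
proof
  show "rcis (root k (cmod s)) (Arg s / real k) ^ k = s"
    using assms by (simp add: DeMoivre2 rcis_cmod_Arg)
qed

text \<open>After rotation by \<open>- (real k * d)\<close> the sector lies around the positive
  axis. The bound 1 on its opening keeps the angle below 1/2, hence in the right half plane, where
  \<open>Ln\<close> is holomorphic and inverts \<open>exp\<close>; dividing the logarithm by
  \<open>k\<close> and rotating back by \<open>d\<close> gives the root.\<close>

lemma holomorphic_sector_root:
  assumes k: "k \<ge> 1" and \<alpha>: "real k * \<alpha> \<le> 1"
  shows "\<exists>\<psi>. \<psi> holomorphic_on sector (real k * d) (real k * \<alpha>) \<and>
    (\<forall>s\<in>sector (real k * d) (real k * \<alpha>). \<psi> s \<in> sector d \<alpha> \<and> \<psi> s ^ k = s)"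
proof -
  define \<psi> where "\<psi> s = exp (Ln (s * cis (- (real k * d))) / of_nat k) * cis d" for s
  have *: "s * cis (- (real k * d)) \<notin> \<real>\<^sub>\<le>\<^sub>0 \<and> \<psi> s \<in> sector d \<alpha> \<and> \<psi> s ^ k = s"
    if s: "s \<in> sector (real k * d) (real k * \<alpha>)" for s
  proof -
    obtain \<sigma> \<phi> where p: "s = rcis \<sigma> \<phi>" "\<sigma> > 0" "\<bar>\<phi> - real k * d\<bar> < real k * \<alpha> / 2"
      using s by (auto simp: sector_def)
    define \<omega> where "\<omega> = \<phi> - real k * d"
    have \<omega>: "\<bar>\<omega>\<bar> < 1 / 2" "\<bar>\<omega>\<bar> < real k * \<alpha> / 2"
      using p(3) \<alpha> by (auto simp: \<omega>_def)
    have pi: "pi > 3" using pi_gt3 .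
    define w where "w = Complex (ln \<sigma>) \<omega>"
    have s': "s * cis (- (real k * d)) = exp w"
      using p(2) by (simp add: p(1) rcis_def w_def exp_eq_polar cis_mult mult.assoc \<omega>_def)
    have Ln: "Ln (exp w) = w"
      using \<omega>(1) pi by (intro Ln_exp) (auto simp: w_def)
    have "cos \<omega> > 0"
      using \<omega>(1) pi by (intro cos_gt_zero_pi) linarith+
    then have "Re (exp w) > 0" by (simp add: Re_exp w_def)
    then have 1: "s * cis (- (real k * d)) \<notin> \<real>\<^sub>\<le>\<^sub>0"
      unfolding s' by (simp add: complex_nonpos_Reals_iff)
    have "w / of_nat k = Complex (ln \<sigma> / real k) (\<omega> / real k)"
      by (simp add: w_def complex_eq_iff)
    then have psi: "\<psi> s = rcis (exp (ln \<sigma> / real k)) (\<omega> / real k + d)"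
      unfolding \<psi>_def s' Ln by (simp add: exp_eq_polar rcis_def cis_mult mult.assoc)
    have "\<bar>\<omega> / real k\<bar> < \<alpha> / 2"
      using \<omega>(2) k by (simp add: abs_divide field_simps)
    then have 2: "\<psi> s \<in> sector d \<alpha>"
      unfolding psi sector_def by (auto intro!: exI)
    have "\<psi> s ^ k = exp (Ln (exp w)) * cis (real k * d)"
      unfolding \<psi>_def s' power_mult_distrib using k
      by (simp add: exp_divide_power_eq Complex.DeMoivre)
    also have "\<dots> = (s * cis (- (real k * d))) * cis (real k * d)"
      by (simp only: Ln s')
    also have "\<dots> = s"
      by (simp add: mult.assoc cis_mult)
    finally show ?thesis using 1 2 by blast
  qed
  show ?thesis
  proof (intro exI conjI)
    show "\<psi> holomorphic_on sector (real k * d) (real k * \<alpha>)"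
      unfolding \<psi>_def using * k by (intro holomorphic_intros) auto
  qed (use * in blast)
qed

lemma sums_multiples_iff:
  fixes h :: "nat \<Rightarrow> complex"
  assumes "k \<ge> 1"
  shows "(\<lambda>n. (if k dvd n then h (n div k) else 0) * t ^ n) sums y \<longleftrightarrow>
    (\<lambda>m. h m * (t ^ k) ^ m) sums y"
proof -
  have "strict_mono (\<lambda>m. k * m)" using assms by (intro strict_monoI) simp
  moreover have "(if k dvd n then h (n div k) else 0) * t ^ n = 0" if "n \<notin> range (\<lambda>m. k * m)" for n
    using that by (auto simp: dvd_def)
  ultimately have "(\<lambda>m. (if k dvd k * m then h (k * m div k) else 0) * t ^ (k * m)) sums y \<longleftrightarrow>
    (\<lambda>n. (if k dvd n then h (n div k) else 0) * t ^ n) sums y"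
    by (rule sums_mono_reindex)
  then show ?thesis using assms by (simp add: power_mult)
qed

text \<open>Only powers of t^k occur, so near 0 the value of \<open>H\<close> depends on s = t^k
  alone and is the sum of a power series in s; in the sector the root branch expresses it as a
  function of s. Growth of order \<open>k\<close> in t is growth of order 1 in s.\<close>

lemma fps_continues_descend:
  fixes H :: "complex \<Rightarrow> complex"
  assumes k: "k \<ge> 1" and \<alpha>: "\<alpha> > 0" and \<rho>: "\<rho> > 0"
    and hol: "H holomorphic_on sector_hat d \<alpha> \<rho>"
    and bound: "exp_growth (real k) d \<alpha> \<rho> (\<lambda>t. cmod (H t))"
    and \<delta>: "\<delta> > 0"
    and sums: "\<And>t. t \<in> ball 0 \<delta> \<Longrightarrow>
      (\<lambda>n. (if k dvd n then h (n div k) else 0) * t ^ n) sums H t"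
  shows "fps_continues (real k * d) (Abs_fps h)"
proof -
  \<comment> \<open>1/k meets the requirement of the root branch; \<alpha>/2 and \<rho>/2 make the
    opening and radius strictly smaller, so that one growth bound is valid throughout.\<close>
  define \<beta> where "\<beta> = min (\<alpha> / 2) (1 / real k)"
  define \<sigma> where "\<sigma> = min (\<rho> / 2) \<delta>"
  define R where "R = \<sigma> ^ k"
  have \<beta>: "0 < \<beta>" "\<beta> < \<alpha>" "real k * \<beta> \<le> 1"
    using k \<alpha> by (auto simp: \<beta>_def min_def field_simps)
  have \<sigma>: "0 < \<sigma>" "\<sigma> < \<rho>" "\<sigma> \<le> \<delta>" using \<rho> \<delta> by (auto simp: \<sigma>_def)
  have R: "R > 0" using \<sigma> by (simp add: R_def)
  obtain C a where Ca: "\<And>t. t \<in> sector_hat d \<beta> \<sigma> \<Longrightarrow> cmod (H t) \<le> C * exp (a * cmod t powr real k)"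
    using bound \<beta> \<sigma> unfolding exp_growth_def by (metis greaterThanLessThan_iff)
  have powr: "cmod t powr real k = cmod t ^ k" for t
    using k by (cases "t = 0") (auto simp: powr_realpow)
  obtain \<psi> where \<psi>: "\<psi> holomorphic_on sector (real k * d) (real k * \<beta>)"
    "\<forall>s\<in>sector (real k * d) (real k * \<beta>). \<psi> s \<in> sector d \<beta> \<and> \<psi> s ^ k = s"
    using holomorphic_sector_root[OF k \<beta>(3), of d] by blast
  have small: "cmod t < \<sigma>" if "cmod (t ^ k) < R" for t
    using that \<sigma>(1) unfolding R_def norm_power by (auto intro: power_less_imp_less_base)
  have sumsH: "(\<lambda>m. h m * (t ^ k) ^ m) sums H t" if "cmod (t ^ k) < R" for t
    using sums[of t] small[OF that] \<sigma>(3) sums_multiples_iff[OF k] by simp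
  define p where "p s = (\<Sum>m. h m * s ^ m)" for s
  have p: "(\<lambda>m. h m * s ^ m) sums p s \<and> (\<exists>t. cmod t < \<sigma> \<and> t ^ k = s \<and> p s = H t)" if "cmod s < R" for s
  proof -
    obtain t where t: "t ^ k = s" using complex_root_exists[OF k] .
    have "(\<lambda>m. h m * s ^ m) sums H t" using sumsH[of t] t that by simp
    then show ?thesis
      unfolding p_def using small[of t] t that by (auto simp: sums_iff)
  qed
  \<comment> \<open>No single branch of the root exists on the disc, so the power series is used
    there. On the overlap with the sector both expressions are sums of the same series.\<close>
  define g where "g s = (if s \<in> ball 0 R then p s else H (\<psi> s))" for s
  have g_sector: "g s = H (\<psi> s)" if "s \<in> sector (real k * d) (real k * \<beta>)" for s
  proof (cases "s \<in> ball 0 R")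
    case True
    then have "cmod s < R" by simp
    then have "p s = H (\<psi> s)"
      using p[of s] sumsH[of "\<psi> s"] bspec[OF \<psi>(2) that] by (auto intro: sums_unique2)
    then show ?thesis using True by (simp add: g_def)
  qed (simp add: g_def)
  have "sector_exp_fun (real k * d) (real k * \<beta>) R g"
  proof (rule sector_exp_funI)
    have "g holomorphic_on ball 0 R"
    proof -
      have "p holomorphic_on ball 0 R"
        using p by (intro power_series_holomorphic[where a = h and z = 0]) (auto simp: dist_norm)
      then show ?thesis by (rule holomorphic_transform) (simp add: g_def)
    qed
    moreover have "g holomorphic_on sector (real k * d) (real k * \<beta>)"
    proof -
      have "H \<circ> \<psi> holomorphic_on sector (real k * d) (real k * \<beta>)"
      proof (rule holomorphic_on_compose_gen[OF \<psi>(1) hol])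
        have "sector d \<beta> \<subseteq> sector_hat d \<alpha> \<rho>"
          using sector_hat_mono[of \<beta> \<alpha> \<rho> \<rho> d] \<beta> by (auto simp: sector_hat_def)
        then show "\<psi> ` sector (real k * d) (real k * \<beta>) \<subseteq> sector_hat d \<alpha> \<rho>"
          using \<psi>(2) by blast
      qed
      then show ?thesis by (rule holomorphic_transform) (simp add: g_sector)
    qed
    ultimately show "g holomorphic_on sector_hat (real k * d) (real k * \<beta>) R"
      unfolding sector_hat_def by (intro holomorphic_on_Un open_sector open_ball)
  next
    fix s assume s: "s \<in> sector_hat (real k * d) (real k * \<beta>) R"
    \<comment> \<open>For small s any k-th root will do, since it lies in the disc of radius
      \<sigma> even when it misses the sector.\<close>
    have "\<exists>t\<in>sector_hat d \<beta> \<sigma>. t ^ k = s \<and> g s = H t"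
    proof (cases "s \<in> ball 0 R")
      case True
      then show ?thesis using p[of s] by (auto simp: g_def sector_hat_def)
    next
      case False
      then have "s \<in> sector (real k * d) (real k * \<beta>)" using s by (simp add: sector_hat_def)
      then show ?thesis using \<psi>(2) g_sector[of s] by (auto simp: sector_hat_def)
    qed
    then obtain t where t: "t \<in> sector_hat d \<beta> \<sigma>" "t ^ k = s" "g s = H t" by blast
    show "cmod (g s) \<le> C * exp (a * cmod s)"
      using Ca[OF t(1)] unfolding powr t(3) by (simp add: norm_power t(2)[symmetric])
  qed
  moreover have "g has_fps_expansion Abs_fps h"
  proof (rule has_fps_expansionI)
    have "\<forall>\<^sub>F s in nhds 0. s \<in> ball 0 R"
      using R by (intro eventually_nhds_in_open) auto
    then show "\<forall>\<^sub>F s in nhds 0. (\<lambda>n. Abs_fps h $ n * s ^ n) sums g s"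
      by eventually_elim (use p in \<open>simp add: g_def\<close>)
  qed
  ultimately show ?thesis
    unfolding fps_continues_def using \<beta>(1) R k
    by (intro exI[of _ "real k * \<beta>"] exI[of _ R] conjI exI[of _ g]) auto
qed

text \<open>If the factor $\zeta - a$ is split off from $P$, the cofactor $Q$ acts on the Borel
  transform $H(s,z) = \sum_m c_m f^{(m)}(z) s^m / m!$ of the formal solution by
  $\sum_j q_j \partial_s^{-j} \partial_z^j$, and the result is the Borel transform
  $-a^{-1} f(z + s/a)$ of the solution of the first-order equation.\<close>

lemma fps_continues_cofactor:
  fixes P Q :: "complex poly" and F :: "nat \<Rightarrow> complex"
  assumes P: "P = [:- a, 1:] * Q" and a: "a \<noteq> 0" and P0: "poly P 0 \<noteq> 0"
    and cont: "\<And>j. fps_continues \<theta>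
      (Abs_fps (\<lambda>m. inverse (fps_of_poly P) $ m * F (m + j) / fact m))"
  shows "fps_continues (\<theta> - Arg a) (Abs_fps (\<lambda>m. F m / fact m))"
proof -
  define c where "c = inverse (fps_of_poly P)"
  \<comment> \<open>\<open>W j i\<close> is the i-fold integral in s of the j-th z-derivative of H
    at z = 0: integration shifts the coefficients by i but puts \<open>fact m\<close> in the
    denominator. Multiplication by \<zeta>^j corresponds to the diagonal i = j.\<close>
  define W where "W j i = Abs_fps (\<lambda>m. if m < i then 0 else c $ (m - i) * F (m - i + j) / fact m)" for i j
  have W: "fps_continues \<theta> (W j i)" for i j
  proof (induction i)
    case 0
    then show ?case using cont[of j] by (simp add: W_def c_def)
  next
    case (Suc i)
    have "W j (Suc i) = fps_integral0 (W j i)"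
    proof (rule fps_ext)
      fix m show "W j (Suc i) $ m = fps_integral0 (W j i) $ m"
        by (cases m) (auto simp: W_def fps_integral_def field_simps simp del: of_nat_Suc)
    qed
    then show ?case using Suc.IH by (simp add: fps_continues_integral)
  qed
  have "fps_of_poly P $ 0 \<noteq> 0" using P0 by (simp add: poly_0_coeff_0)
  then have "fps_of_poly P * c = 1" unfolding c_def by (rule inverse_mult_eq_1')
  then have *: "fps_of_poly [:- a, 1:] * (fps_of_poly Q * c) = 1"
    by (simp only: P fps_of_poly_mult mult.assoc)
  \<comment> \<open>These are the coefficients of Q/P = 1/(\<zeta> - a), read off from the product
    with \<zeta> - a.\<close>
  have Qc: "(fps_of_poly Q * c) $ m = - 1 / a ^ Suc m" for m
  proof (induction m)
    case 0
    have "(fps_of_poly [:- a, 1:] * (fps_of_poly Q * c)) $ 0 = 1" unfolding * by simp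
    then have "- a * (fps_of_poly Q * c) $ 0 = 1" by simp
    then have "a * (fps_of_poly Q * c) $ 0 = - 1" by (metis add.inverse_inverse mult_minus_left)
    then have "(fps_of_poly Q * c) $ 0 = - 1 / a" using a by (metis nonzero_mult_div_cancel_left)
    then show ?case by simp
  next
    case (Suc m)
    have "fps_of_poly [:- a, 1:] = fps_X - fps_const a"
      by (simp add: fps_of_poly_pCons)
    then have "(fps_X - fps_const a) * (fps_of_poly Q * c) = 1" using * by (simp only:)
    then have "((fps_X - fps_const a) * (fps_of_poly Q * c)) $ Suc m = 0" by (simp only: fps_one_nth) simp
    then have "(fps_of_poly Q * c) $ m = a * (fps_of_poly Q * c) $ Suc m"
      by (simp add: left_diff_distrib mult.assoc)
    then show ?case using Suc.IH a by (simp add: field_simps)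
  qed
  have "fps_continues \<theta> (\<Sum>j\<le>degree Q. fps_const (coeff Q j) * W j j)"
    using W by (intro fps_continues_sum fps_continues_cmult) auto
  moreover have "(\<Sum>j\<le>degree Q. fps_const (coeff Q j) * W j j)
      = Abs_fps (\<lambda>m. - F m / (a ^ Suc m * fact m))"
  proof (rule fps_ext)
    fix m
    have "(\<Sum>j\<le>degree Q. fps_const (coeff Q j) * W j j) $ m = (\<Sum>j\<le>degree Q. coeff Q j * W j j $ m)"
      by (simp add: fps_sum_nth)
    \<comment> \<open>On the diagonal \<open>m - j + j = m\<close>, so \<open>F m\<close> leaves the
      sum and the Cauchy product of Q with 1/P remains.\<close>
    also have "\<dots> = (\<Sum>j\<le>m. coeff Q j * c $ (m - j) * (F m / fact m))"
      by (rule sum.mono_neutral_cong) (auto simp: W_def coeff_eq_0)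
    also have "\<dots> = (fps_of_poly Q * c) $ m * (F m / fact m)"
      unfolding fps_mult_nth atLeast0AtMost sum_distrib_right by simp
    finally show "(\<Sum>j\<le>degree Q. fps_const (coeff Q j) * W j j) $ m
      = Abs_fps (\<lambda>m. - F m / (a ^ Suc m * fact m)) $ m"
      by (simp add: Qc)
  qed
  ultimately have "fps_continues \<theta> (Abs_fps (\<lambda>m. - F m / (a ^ Suc m * fact m)))" by simp
  \<comment> \<open>Replacing s by a s cancels \<open>a ^ m\<close> and produces the rotation by
    \<open>- Arg a\<close>; the factor \<open>- a\<close> removes the rest.\<close>
  from fps_continues_cmult[OF fps_continues_scale[OF this a], of "- a"]
  have "fps_continues (\<theta> - Arg a)
    (fps_const (- a) * Abs_fps (\<lambda>m. a ^ m * Abs_fps (\<lambda>m. - F m / (a ^ Suc m * fact m)) $ m))" .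
  also have "fps_const (- a) * Abs_fps (\<lambda>m. a ^ m * Abs_fps (\<lambda>m. - F m / (a ^ Suc m * fact m)) $ m)
      = Abs_fps (\<lambda>m. F m / fact m)"
    using a by (intro fps_ext) (simp add: field_simps)
  finally show ?thesis .
qed

text \<open>Taking the j-th z-derivative at 0 yields one scalar function of t for each j. These
  supply all the series that the cofactor combines, and the result is the Taylor series of
  \<open>f\<close> at 0.\<close>

lemma formal_summable_imp_continues:
  assumes k: "k \<ge> 1" and P0: "poly P 0 \<noteq> 0" and a: "poly P a = 0"
    and f: "f holomorphic_on ball 0 r" and x: "formal_solution r P k f x"
    and r': "0 < r'" "r' \<le> r" and summable: "formal_summable r' (real k) d x"
  shows "continues_with_exp_growth f 1 (real k * d - Arg a)"
proof -
  define c where "c = inverse (fps_of_poly P)"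
  obtain \<alpha> \<rho> G \<delta> where \<alpha>: "\<alpha> > 0" and \<rho>: "\<rho> > 0" and \<delta>: "\<delta> > 0"
    and G: "disc_holomorphic_on r' G (sector_hat d \<alpha> \<rho>)"
    and growth: "exp_growth (real k) d \<alpha> \<rho> (\<lambda>t. disc_norm r' (G t))"
    and sums: "\<forall>t\<in>ball 0 \<delta>. disc_sums r' (\<lambda>n z. formal_borel (real k) x n z * t ^ n) (G t)"
    and xd: "\<And>n. x n \<in> disc_space r'"
    using summable unfolding formal_summable_def by blast
  have Gd: "G t \<in> disc_space r'" if "t \<in> sector_hat d \<alpha> \<rho>" for t
    using G that unfolding disc_holomorphic_on_def by blast
  have coeff: "(deriv ^^ j) (formal_borel (real k) x n) 0
      = (if k dvd n then c $ (n div k) * (deriv ^^ (n div k + j)) f 0 / fact (n div k) else 0)" for j n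
  proof -
    \<comment> \<open>The closed formula equals the coefficient only on the open disc, hence the
      transfer of derivatives within an open set.\<close>
    define B where "B = (\<lambda>z. if k dvd n then (c $ (n div k) / fact (n div k)) * (deriv ^^ (n div k)) f z else 0)"
    have "formal_borel (real k) x n z = B z" if "z \<in> ball 0 r'" for z
    proof -
      \<comment> \<open>For n = k m the argument is the integer m + 1: the Borel transform of order
        k in t is that of order 1 in t^k.\<close>
      have "Gamma (1 + real n / real k) = fact (n div k)" if "k dvd n"
        using that k Gamma_fact[of "n div k", where 'a = real] by (auto simp: dvd_def)
      then show ?thesis
        using formal_solution_coeff[OF k P0 f x, of z n] that r' by (auto simp: formal_borel_def B_def c_def)
    qed
    moreover have "formal_borel (real k) x n holomorphic_on ball 0 r'"
      using xd[of n] unfolding formal_borel_def disc_space_def divide_inverse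
      by (auto intro!: holomorphic_intros)
    moreover have fh: "f holomorphic_on ball 0 r'"
      using f r' by (auto intro: holomorphic_on_subset)
    then have "B holomorphic_on ball 0 r'"
      unfolding B_def by (cases "k dvd n") (auto intro!: holomorphic_intros holomorphic_higher_deriv)
    ultimately have "(deriv ^^ j) (formal_borel (real k) x n) 0 = (deriv ^^ j) B 0"
      using r' by (intro higher_deriv_transform_within_open[where S = "ball 0 r'"]) auto
    also have "\<dots> = (if k dvd n then c $ (n div k) * (deriv ^^ (n div k + j)) f 0 / fact (n div k) else 0)"
    proof (cases "k dvd n")
      case True
      have "(deriv ^^ j) B 0 = (c $ (n div k) / fact (n div k)) * (deriv ^^ j) ((deriv ^^ (n div k)) f) 0"
        unfolding B_def using True r'
        by (simp only: if_True, intro higher_deriv_cmult[where A = "ball 0 r'"])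
          (auto intro: holomorphic_higher_deriv fh)
      also have "(deriv ^^ j) ((deriv ^^ (n div k)) f) = (deriv ^^ (n div k + j)) f"
        by (metis add.commute funpow_add o_apply)
      finally show ?thesis using True by simp
    qed (simp add: B_def)
    finally show ?thesis .
  qed
  have cont: "fps_continues (real k * d) (Abs_fps (\<lambda>m. c $ m * (deriv ^^ (m + j)) f 0 / fact m))" for j
  proof (rule fps_continues_descend[OF k \<alpha> \<rho>])
    show "(\<lambda>t. (deriv ^^ j) (G t) 0) holomorphic_on sector_hat d \<alpha> \<rho>"
      using G open_sector_hat r'(1) by (rule disc_holomorphic_higher_deriv)
    show "exp_growth (real k) d \<alpha> \<rho> (\<lambda>t. cmod ((deriv ^^ j) (G t) 0))"
      unfolding exp_growth_def
    proof (intro ballI)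
      fix \<alpha>' \<rho>' assume m: "\<alpha>' \<in> {0<..<\<alpha>}" "\<rho>' \<in> {0<..<\<rho>}"
      then obtain C a where Ca: "\<forall>t\<in>sector_hat d \<alpha>' \<rho>'. disc_norm r' (G t) \<le> C * exp (a * cmod t powr real k)"
        using growth unfolding exp_growth_def by blast
      have "cmod ((deriv ^^ j) (G t) 0) \<le> (fact j / r' ^ j * C) * exp (a * cmod t powr real k)"
        if t: "t \<in> sector_hat d \<alpha>' \<rho>'" for t
      proof -
        have "t \<in> sector_hat d \<alpha> \<rho>" using t m sector_hat_mono[of \<alpha>' \<alpha> \<rho>' \<rho> d] by auto
        then have "cmod ((deriv ^^ j) (G t) 0) \<le> fact j / r' ^ j * disc_norm r' (G t)"
          using Gd r'(1) by (intro disc_space_higher_deriv_bound)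
        also have "\<dots> \<le> fact j / r' ^ j * (C * exp (a * cmod t powr real k))"
          using Ca t r'(1) by (intro mult_left_mono) auto
        finally show ?thesis by (simp add: mult.assoc)
      qed
      then show "\<exists>C a. \<forall>t\<in>sector_hat d \<alpha>' \<rho>'. cmod ((deriv ^^ j) (G t) 0) \<le> C * exp (a * cmod t powr real k)"
        by blast
    qed
    fix t :: complex assume t: "t \<in> ball 0 \<delta>"
    have bd: "formal_borel (real k) x n \<in> disc_space r'" for n
      using disc_space_cmult[OF xd[of n], of "1 / of_real (Gamma (1 + real n / real k))"]
      unfolding formal_borel_def by simp
    have bd': "(\<lambda>z. formal_borel (real k) x n z * t ^ n) \<in> disc_space r'" for n
      using disc_space_cmult[OF bd[of n], of "t ^ n"] by (simp add: mult.commute)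
    have "(deriv ^^ j) (\<lambda>z. formal_borel (real k) x n z * t ^ n) 0
        = (deriv ^^ j) (formal_borel (real k) x n) 0 * t ^ n" for n
      using higher_deriv_cmult[of "formal_borel (real k) x n" "ball 0 r'" 0 j "t ^ n"] bd[of n] r'(1)
      by (simp add: disc_space_def mult.commute)
    then show "(\<lambda>n. (if k dvd n then c $ (n div k) * (deriv ^^ (n div k + j)) f 0 / fact (n div k) else 0) * t ^ n)
        sums (deriv ^^ j) (G t) 0"
      using disc_sums_higher_deriv[OF bspec[OF sums t] bd' r'(1), of j] by (simp add: coeff)
  qed (rule \<delta>)
  obtain Q where Q: "P = [:- a, 1:] * Q"
    using a by (auto simp: poly_eq_0_iff_dvd dvd_def)
  have "a \<noteq> 0" using a P0 by auto
  with Q have "fps_continues (real k * d - Arg a) (Abs_fps (\<lambda>m. (deriv ^^ m) f 0 / fact m))"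
    using P0 cont[unfolded c_def]
    by (rule fps_continues_cofactor[where F = "\<lambda>m. (deriv ^^ m) f 0"])
  moreover have "f has_fps_expansion Abs_fps (\<lambda>m. (deriv ^^ m) f 0 / fact m)"
  proof -
    have "f analytic_on {0}"
      unfolding analytic_at using f r' by (intro exI[of _ "ball 0 r"]) auto
    then show ?thesis
      using analytic_at_imp_has_fps_expansion_0 by (simp add: fps_expansion_def)
  qed
  ultimately show ?thesis using continues_iff_fps_continues by blast
qed

section \<open>Partial fractions\<close>

text \<open>The basis is chosen for its effect on the Borel side: multiplying the coefficient of $u^j$
  in $f(z + u)$ by $\binom{j}{i}$ yields $u^i f^{(i)}(z + u) / i!$.\<close>

definition binomial_geometric :: "complex \<Rightarrow> nat \<Rightarrow> complex fps" where
  "binomial_geometric b i = Abs_fps (\<lambda>j. of_nat (j choose i) / b ^ j)"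

text \<open>An inductive span avoids indexing by roots and multiplicities, and properties linear in
  the series follow by rule induction. The element 1 starts the induction on the degree of
  P.\<close>

inductive_set fraction_span :: "complex set \<Rightarrow> complex fps set" for B where
  one: "1 \<in> fraction_span B"
| base: "b \<in> B \<Longrightarrow> binomial_geometric b i \<in> fraction_span B"
| add: "F \<in> fraction_span B \<Longrightarrow> G \<in> fraction_span B \<Longrightarrow> F + G \<in> fraction_span B"
| cmult: "F \<in> fraction_span B \<Longrightarrow> fps_const c * F \<in> fraction_span B"

lemma fraction_span_diff:
  assumes "F \<in> fraction_span B" "G \<in> fraction_span B"
  shows "F - G \<in> fraction_span B"
proof -
  have "F + fps_const (- 1) * G \<in> fraction_span B"
    using assms by (intro fraction_span.add fraction_span.cmult)
  also have "F + fps_const (- 1) * G = F - G"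
    by (rule fps_ext) simp
  finally show ?thesis .
qed

lemma geometric_mult_linear:
  assumes "b \<noteq> 0"
  shows "(1 - fps_const (1 / b) * fps_X) * binomial_geometric b 0 = 1"
proof (rule fps_ext)
  fix n show "((1 - fps_const (1 / b) * fps_X) * binomial_geometric b 0) $ n = 1 $ n"
    using assms by (cases n) (auto simp: binomial_geometric_def left_diff_distrib mult.assoc)
qed

text \<open>Pascal's rule. Together with the geometric series it shows that
  \<open>binomial_geometric b i\<close> is (X/b)^i / (1 - X/b)^(i+1), a fraction with a pole of
  order i + 1 at b.\<close>

lemma binomial_geometric_Suc_mult_linear:
  assumes "b \<noteq> 0"
  shows "(1 - fps_const (1 / b) * fps_X) * binomial_geometric b (Suc i)
    = fps_const (1 / b) * fps_X * binomial_geometric b i"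
proof (rule fps_ext)
  fix n show "((1 - fps_const (1 / b) * fps_X) * binomial_geometric b (Suc i)) $ n
    = (fps_const (1 / b) * fps_X * binomial_geometric b i) $ n"
    using assms
    by (cases n) (auto simp: binomial_geometric_def left_diff_distrib mult.assoc field_simps)
qed

text \<open>Multiplying the right-hand side by 1 - X/b gives (X/b) B + (1 - X/b) B = B for B =
  \<open>binomial_geometric b i\<close>. Thus raising the order of the pole stays inside the
  span.\<close>

lemma geometric_mult_binomial_geometric:
  assumes "b \<noteq> 0"
  shows "binomial_geometric b 0 * binomial_geometric b i
    = binomial_geometric b (Suc i) + binomial_geometric b i"
proof -
  let ?L = "1 - fps_const (1 / b) * fps_X"
  have "?L * (binomial_geometric b (Suc i) + binomial_geometric b i) = binomial_geometric b i"
    unfolding distrib_left binomial_geometric_Suc_mult_linear[OF assms]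
    by (simp add: algebra_simps)
  then have "binomial_geometric b 0 * binomial_geometric b i
      = (?L * binomial_geometric b 0) * (binomial_geometric b (Suc i) + binomial_geometric b i)"
    by (metis mult.assoc mult.commute)
  then show ?thesis unfolding geometric_mult_linear[OF assms] by simp
qed

text \<open>Two distinct simple poles separate by the identity u (1 - v X) - v (1 - u X) = u -
  v.\<close>

lemma geometric_mult_geometric:
  assumes "b \<noteq> 0" "c \<noteq> 0" "b \<noteq> c"
  obtains \<beta> \<gamma> where "binomial_geometric b 0 * binomial_geometric c 0
    = fps_const \<beta> * binomial_geometric b 0 + fps_const \<gamma> * binomial_geometric c 0"
proof -
  define u v where "u = 1 / b" and "v = 1 / c"
  let ?A = "binomial_geometric b 0" and ?C = "binomial_geometric c 0"
  have uv: "u - v \<noteq> 0" using assms by (simp add: u_def v_def)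
  have A: "(1 - fps_const u * fps_X) * ?A = 1" and C: "(1 - fps_const v * fps_X) * ?C = 1"
    using assms geometric_mult_linear by (auto simp: u_def v_def)
  have eq: "fps_const (u - v) = fps_const u * (1 - fps_const v * fps_X) - fps_const v * (1 - fps_const u * fps_X)"
    by (simp add: algebra_simps flip: fps_const_sub)
  have cross: "(x * V - y * U) * (A * C) = x * A * (V * C) - y * C * (U * A)"
    for x y U V A C :: "complex fps" by (simp add: algebra_simps)
  have "fps_const (u - v) * (?A * ?C)
      = fps_const u * ?A * ((1 - fps_const v * fps_X) * ?C)
        - fps_const v * ?C * ((1 - fps_const u * fps_X) * ?A)"
    unfolding eq by (rule cross)
  then have *: "fps_const (u - v) * (?A * ?C) = fps_const u * ?A - fps_const v * ?C"
    unfolding A C by simp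
  have "?A * ?C = fps_const (1 / (u - v)) * (fps_const (u - v) * (?A * ?C))"
    using uv by (simp add: mult.assoc[symmetric])
  also have "\<dots> = fps_const (u / (u - v)) * ?A + fps_const (- v / (u - v)) * ?C"
    unfolding * by (rule fps_ext) (simp add: diff_divide_distrib right_diff_distrib)
  finally show ?thesis using that by blast
qed

text \<open>For a pole at a different point, induction on its order reduces to two simple poles: the
  fraction with index i + 1 is the one with index i times the simple fraction, minus itself.\<close>

lemma geometric_mult_fraction_span:
  assumes B: "0 \<notin> B" and b: "b \<in> B" and F: "F \<in> fraction_span B"
  shows "binomial_geometric b 0 * F \<in> fraction_span B"
  using F
proof induction
  case one
  then show ?case using b by (simp add: fraction_span.base)
next
  case (base c i)
  have same: "binomial_geometric c 0 * binomial_geometric c i \<in> fraction_span B" for i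
  proof -
    have "c \<noteq> 0" using B base by metis
    then show ?thesis
      unfolding geometric_mult_binomial_geometric[OF \<open>c \<noteq> 0\<close>]
      using base by (intro fraction_span.add fraction_span.base)
  qed
  show ?case
  proof (cases "b = c")
    case True
    then show ?thesis using same by simp
  next
    case False
    have 0: "b \<noteq> 0" "c \<noteq> 0" using B b base by metis+
    obtain \<beta> \<gamma> where eq: "binomial_geometric b 0 * binomial_geometric c 0
        = fps_const \<beta> * binomial_geometric b 0 + fps_const \<gamma> * binomial_geometric c 0"
      using geometric_mult_geometric[OF 0 False] .
    show ?thesis
    proof (induction i)
      case 0
      show ?case unfolding eq
        using base b by (intro fraction_span.add fraction_span.cmult fraction_span.base)
    next
      case (Suc i)
      have c: "binomial_geometric c (Suc i)
          = binomial_geometric c 0 * binomial_geometric c i - binomial_geometric c i"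
        using geometric_mult_binomial_geometric[OF 0(2)] by simp
      have "binomial_geometric b 0 * binomial_geometric c (Suc i)
          = (binomial_geometric b 0 * binomial_geometric c 0) * binomial_geometric c i
            - binomial_geometric b 0 * binomial_geometric c i"
        unfolding c by (simp add: right_diff_distrib mult.assoc)
      also have "\<dots> = (fps_const \<beta> * (binomial_geometric b 0 * binomial_geometric c i)
            + fps_const \<gamma> * (binomial_geometric c 0 * binomial_geometric c i))
            - binomial_geometric b 0 * binomial_geometric c i"
        unfolding eq by (simp add: distrib_right mult.assoc)
      finally show ?case
        using Suc.IH same[of i]
        by (auto intro!: fraction_span_diff fraction_span.add fraction_span.cmult)
    qed
  qed
next
  case (add F G)
  then show ?case by (simp add: distrib_left fraction_span.add)
next
  case (cmult F c)
  have eq: "binomial_geometric b 0 * (fps_const c * F) = fps_const c * (binomial_geometric b 0 * F)"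
    by (simp add: mult_ac)
  show ?case unfolding eq using cmult.IH by (rule fraction_span.cmult)
qed

text \<open>Linear factors are split off one at a time. \<open>B\<close> only has to contain the
  roots, so it can stay fixed while the polynomial changes.\<close>

lemma inverse_poly_in_fraction_span:
  assumes "poly P 0 \<noteq> 0" "{\<zeta>. poly P \<zeta> = 0} \<subseteq> B" "0 \<notin> B"
  shows "inverse (fps_of_poly P) \<in> fraction_span B"
  using assms(1,2)
proof (induction "degree P" arbitrary: P)
  case 0
  then obtain p where P: "P = [:p:]" using degree_eq_zeroE by metis
  have "fps_const (inverse p) * 1 \<in> fraction_span B"
    by (intro fraction_span.cmult fraction_span.one)
  then show ?case by (simp add: P fps_of_poly_const fps_const_inverse)
next
  case (Suc n)
  have "coeff P (degree P) \<noteq> 0" "degree P \<in> {1..degree P}"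
    using Suc.hyps(2) by auto
  then have "\<exists>i\<in>{1..degree P}. coeff P i \<noteq> 0" by blast
  then obtain b where b: "poly P b = 0"
    using fundamental_theorem_of_algebra[of "coeff P" "degree P"] unfolding poly_altdef by blast
  then obtain Q where P: "P = [:- b, 1:] * Q" by (auto simp: poly_eq_0_iff_dvd dvd_def)
  have Q0: "poly Q 0 \<noteq> 0" using Suc.prems(1) by (auto simp: P)
  then have "degree P = Suc (degree Q)" unfolding P by (subst degree_mult_eq) auto
  then have IH: "inverse (fps_of_poly Q) \<in> fraction_span B"
    using Suc Q0 by (auto simp: P)
  have b0: "b \<noteq> 0" using b Suc.prems(1) by auto
  have "fps_of_poly [:- b, 1:] = fps_const (- b) * (1 - fps_const (1 / b) * fps_X)"
    by (rule fps_ext) (use b0 in \<open>auto simp: fps_of_poly_pCons coeff_pCons fps_X_def algebra_simps\<close>)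
  then have "fps_of_poly [:- b, 1:] * (fps_const (- 1 / b) * binomial_geometric b 0)
      = (fps_const (- b) * fps_const (- 1 / b)) * ((1 - fps_const (1 / b) * fps_X) * binomial_geometric b 0)"
    by (simp only: mult_ac)
  also have "\<dots> = 1"
    unfolding geometric_mult_linear[OF b0] using b0 by (simp add: fps_const_mult)
  finally have "inverse (fps_of_poly [:- b, 1:]) = fps_const (- 1 / b) * binomial_geometric b 0"
    by (rule fps_inverse_unique)
  then have eq: "inverse (fps_of_poly P)
      = fps_const (- 1 / b) * (binomial_geometric b 0 * inverse (fps_of_poly Q))"
    unfolding P fps_of_poly_mult fps_inverse_mult by (simp add: mult.assoc)
  have "b \<in> B" using b Suc.prems(2) by auto
  then show ?case
    unfolding eq by (intro fraction_span.cmult geometric_mult_fraction_span assms(3) IH)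
qed

section \<open>From continuation to summability\<close>

lemma power_le_fact_mult_exp:
  assumes "(x::real) \<ge> 0"
  shows "x ^ i \<le> fact i * exp x"
proof -
  have "(\<Sum>n\<in>{i}. x ^ n /\<^sub>R fact n) \<le> (\<Sum>n. x ^ n /\<^sub>R fact n)"
    using assms by (intro sum_le_suminf sums_summable[OF exp_converges]) auto
  also have "\<dots> = exp x" using exp_converges sums_unique by metis
  finally show ?thesis by (simp add: field_simps)
qed

text \<open>The Borel transform with arbitrary \<open>c\<close> in place of 1/P, hence linear in
  \<open>c\<close>. A single \<eta> serves as opening, radius in t and radius in z, so sums need no
  intersection of domains; \<open>at_right 0\<close> supplies an \<eta> common to all
  summands.\<close>

definition borel_continues ::
    "nat \<Rightarrow> real \<Rightarrow> (complex \<Rightarrow> complex) \<Rightarrow> real \<Rightarrow> complex fps \<Rightarrow> bool" where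
  "borel_continues k d f \<eta> c \<longleftrightarrow> (\<exists>G C a. C \<ge> 0 \<and> a \<ge> 0 \<and>
     (\<forall>t\<in>sector_hat d \<eta> \<eta>. G t \<in> disc_space \<eta>) \<and>
     (\<forall>z\<in>cball 0 \<eta>. (\<lambda>t. G t z) holomorphic_on sector_hat d \<eta> \<eta>) \<and>
     (\<forall>t\<in>sector_hat d \<eta> \<eta>. \<forall>z\<in>cball 0 \<eta>. cmod (G t z) \<le> C * exp (a * cmod t ^ k)) \<and>
     (\<forall>t\<in>ball 0 \<eta>. \<forall>z\<in>cball 0 \<eta>.
        (\<lambda>j. c $ j * ((deriv ^^ j) f z / fact j) * (t ^ k) ^ j) sums G t z))"

lemma borel_continues_add:
  assumes "borel_continues k d f \<eta> c" "borel_continues k d f \<eta> c'"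
  shows "borel_continues k d f \<eta> (c + c')"
proof -
  let ?S = "sector_hat d \<eta> \<eta>"
  obtain G C a where G: "C \<ge> 0" "a \<ge> 0" "\<forall>t\<in>?S. G t \<in> disc_space \<eta>"
    "\<forall>z\<in>cball 0 \<eta>. (\<lambda>t. G t z) holomorphic_on ?S"
    "\<forall>t\<in>?S. \<forall>z\<in>cball 0 \<eta>. cmod (G t z) \<le> C * exp (a * cmod t ^ k)"
    "\<forall>t\<in>ball 0 \<eta>. \<forall>z\<in>cball 0 \<eta>. (\<lambda>j. c $ j * ((deriv ^^ j) f z / fact j) * (t ^ k) ^ j) sums G t z"
    using assms(1) unfolding borel_continues_def by blast
  obtain G' C' a' where G': "C' \<ge> 0" "a' \<ge> 0" "\<forall>t\<in>?S. G' t \<in> disc_space \<eta>"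
    "\<forall>z\<in>cball 0 \<eta>. (\<lambda>t. G' t z) holomorphic_on ?S"
    "\<forall>t\<in>?S. \<forall>z\<in>cball 0 \<eta>. cmod (G' t z) \<le> C' * exp (a' * cmod t ^ k)"
    "\<forall>t\<in>ball 0 \<eta>. \<forall>z\<in>cball 0 \<eta>. (\<lambda>j. c' $ j * ((deriv ^^ j) f z / fact j) * (t ^ k) ^ j) sums G' t z"
    using assms(2) unfolding borel_continues_def by blast
  have "cmod (G t z + G' t z) \<le> (C + C') * exp (max a a' * cmod t ^ k)"
    if t: "t \<in> ?S" and z: "z \<in> cball 0 \<eta>" for t z
  proof -
    have "cmod (G t z + G' t z) \<le> C * exp (a * cmod t ^ k) + C' * exp (a' * cmod t ^ k)"
      using G(5) G'(5) t z norm_triangle_ineq[of "G t z" "G' t z"] by fastforce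
    also have "\<dots> \<le> C * exp (max a a' * cmod t ^ k) + C' * exp (max a a' * cmod t ^ k)"
      using G(1) G'(1) by (intro add_mono mult_left_mono) (auto intro!: mult_right_mono)
    finally show ?thesis by (simp add: distrib_right)
  qed
  moreover have "(\<lambda>j. (c + c') $ j * ((deriv ^^ j) f z / fact j) * (t ^ k) ^ j) sums (G t z + G' t z)"
    if "t \<in> ball 0 \<eta>" "z \<in> cball 0 \<eta>" for t z
    using sums_add[OF G(6)[rule_format, OF that] G'(6)[rule_format, OF that]]
    by (simp add: distrib_right add_divide_distrib)
  moreover have "(\<lambda>z. G t z + G' t z) \<in> disc_space \<eta>" if "t \<in> ?S" for t
    using G(3) G'(3) that by (auto simp: disc_space_def intro!: holomorphic_intros continuous_intros)
  moreover have "(\<lambda>t. G t z + G' t z) holomorphic_on ?S" if "z \<in> cball 0 \<eta>" for z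
    using G(4) G'(4) that by (auto intro!: holomorphic_intros)
  ultimately show ?thesis
    unfolding borel_continues_def using G(1,2) G'(1,2)
    by (intro exI[of _ "\<lambda>t z. G t z + G' t z"] exI[of _ "C + C'"] exI[of _ "max a a'"]) auto
qed

lemma borel_continues_cmult:
  assumes "borel_continues k d f \<eta> c"
  shows "borel_continues k d f \<eta> (fps_const b * c)"
proof -
  let ?S = "sector_hat d \<eta> \<eta>"
  obtain G C a where G: "C \<ge> 0" "a \<ge> 0" "\<forall>t\<in>?S. G t \<in> disc_space \<eta>"
    "\<forall>z\<in>cball 0 \<eta>. (\<lambda>t. G t z) holomorphic_on ?S"
    "\<forall>t\<in>?S. \<forall>z\<in>cball 0 \<eta>. cmod (G t z) \<le> C * exp (a * cmod t ^ k)"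
    "\<forall>t\<in>ball 0 \<eta>. \<forall>z\<in>cball 0 \<eta>. (\<lambda>j. c $ j * ((deriv ^^ j) f z / fact j) * (t ^ k) ^ j) sums G t z"
    using assms unfolding borel_continues_def by blast
  have "cmod (b * G t z) \<le> (cmod b * C) * exp (a * cmod t ^ k)"
    if t: "t \<in> ?S" and z: "z \<in> cball 0 \<eta>" for t z
    using mult_left_mono[OF G(5)[rule_format, OF t z] norm_ge_zero[of b]]
    by (simp add: norm_mult mult.assoc)
  moreover have "(\<lambda>j. (fps_const b * c) $ j * ((deriv ^^ j) f z / fact j) * (t ^ k) ^ j) sums (b * G t z)"
    if "t \<in> ball 0 \<eta>" "z \<in> cball 0 \<eta>" for t z
    using sums_mult[OF G(6)[rule_format, OF that], of b] by (simp add: mult.assoc)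
  moreover have "(\<lambda>z. b * G t z) \<in> disc_space \<eta>" if "t \<in> ?S" for t
    using G(3) that by (auto intro: disc_space_cmult)
  moreover have "(\<lambda>t. b * G t z) holomorphic_on ?S" if "z \<in> cball 0 \<eta>" for z
    using G(4) that by (auto intro!: holomorphic_intros)
  ultimately show ?thesis
    unfolding borel_continues_def using G(1,2)
    by (intro exI[of _ "\<lambda>t z. b * G t z"] exI[of _ "cmod b * C"] exI[of _ a]) auto
qed

lemma borel_continues_one:
  assumes f: "f holomorphic_on ball 0 r" and \<eta>: "0 < \<eta>" "\<eta> < r"
  shows "borel_continues k d f \<eta> 1"
proof -
  have f': "f holomorphic_on cball 0 \<eta>"
    using f by (rule holomorphic_on_subset) (use \<eta> in auto)
  then have fd: "f \<in> disc_space \<eta>"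
    using holomorphic_on_subset[OF f' ball_subset_cball] holomorphic_on_imp_continuous_on
    by (auto simp: disc_space_def)
  have "cmod (f z) \<le> disc_norm \<eta> f * exp (0 * cmod t ^ k)" if "z \<in> cball 0 \<eta>" for t z
    using disc_norm_upper[OF fd that] by simp
  moreover have "(\<lambda>j. (1::complex fps) $ j * ((deriv ^^ j) f z / fact j) * (t ^ k) ^ j) sums f z" for t z
  proof -
    have "(\<lambda>j. if j = 0 then f z else 0) sums f z"
      by (rule sums_single)
    also have "(\<lambda>j. if j = 0 then f z else 0)
        = (\<lambda>j. (1::complex fps) $ j * ((deriv ^^ j) f z / fact j) * (t ^ k) ^ j)"
      by (rule ext) simp
    finally show ?thesis .
  qed
  ultimately show ?thesis
    unfolding borel_continues_def using fd disc_norm_nonneg[OF fd] \<eta>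
    by (intro exI[of _ "\<lambda>t. f"] exI[of _ "disc_norm \<eta> f"] exI[of _ 0]) auto
qed

text \<open>By Taylor expansion at z, the continuation is u^i f^(i)(z + u) / i! with u = t^k / b.
  The shift by z is harmless because discs of a fixed radius around the values of u stay in a larger
  sector.\<close>

lemma borel_continues_binomial_geometric:
  assumes k: "k \<ge> 1" and b: "b \<noteq> 0"
    and cont: "continues_with_exp_growth f 1 (real k * d - Arg b)"
  shows "\<forall>\<^sub>F \<eta> in at_right 0. borel_continues k d f \<eta> (binomial_geometric b i)"
proof -
  define \<theta> where "\<theta> = real k * d - Arg b"
  obtain \<alpha> R g where \<alpha>: "\<alpha> > 0" and R: "R > 0" and g: "sector_exp_fun \<theta> \<alpha> R g"
    and ev: "\<forall>\<^sub>F z in nhds 0. g z = f z"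
    using cont unfolding continues_with_exp_growth_iff \<theta>_def by blast
  obtain e0 where e0: "e0 > 0" "\<And>z. z \<in> ball 0 e0 \<Longrightarrow> g z = f z"
    using ev unfolding eventually_nhds_metric by (auto simp: dist_norm)
  have "sector_exp_fun \<theta> (\<alpha> / 2) (R / 2) ((deriv ^^ i) g)"
    using g \<alpha> R by (intro sector_exp_fun_higher_deriv) auto
  then obtain C a where Ca: "C \<ge> 0" "a \<ge> 0"
    and gi: "(deriv ^^ i) g holomorphic_on sector_hat \<theta> (\<alpha> / 2) (R / 2)"
    and le: "\<forall>t\<in>sector_hat \<theta> (\<alpha> / 2) (R / 2). cmod ((deriv ^^ i) g t) \<le> C * exp (a * cmod t)"
    unfolding sector_exp_fun_def by blast
  obtain e where e: "0 < e"
    "\<And>w. w \<in> sector_hat \<theta> (\<alpha> / 4) (R / 4) \<Longrightarrow> cball w e \<subseteq> sector_hat \<theta> (\<alpha> / 2) (R / 2)"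
    using sector_hat_cball_subset[of "\<alpha> / 4" "\<alpha> / 2" "R / 4" "R / 2" \<theta>] \<alpha> R by auto
  have gR: "g holomorphic_on ball 0 R"
    using g unfolding sector_exp_fun_def sector_hat_def by (auto intro: holomorphic_on_subset)
  \<comment> \<open>\<open>e\<close> keeps z + u in the larger sector, \<open>e0\<close> keeps z
    where \<open>g\<close> equals \<open>f\<close>, \<alpha>/(4k) bounds the opening of the values
    of u; 1 and \<open>cmod b * R / 4\<close> give \<eta>^k \<le> \<eta> and hence |u| \<le> R/4 on
    the disc; R/4 keeps \<open>ball z (R / 2)\<close> inside \<open>ball 0 R\<close>.\<close>
  define E where "E = Min {e, e0, \<alpha> / (4 * real k), 1, cmod b * R / 4, R / 4}"
  have "E > 0" using e(1) e0(1) \<alpha> k b R by (simp add: E_def)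
  have "borel_continues k d f \<eta> (binomial_geometric b i)" if \<eta>: "\<eta> > 0" "\<eta> < E" for \<eta>
  proof -
    let ?S = "sector_hat d \<eta> \<eta>"
    have small: "\<eta> < e" "\<eta> < e0" "\<eta> < \<alpha> / (4 * real k)" "\<eta> < 1" "\<eta> < cmod b * R / 4" "\<eta> < R / 4"
      using \<eta>(2) by (auto simp: E_def)
    have k\<eta>: "real k * \<eta> \<le> \<alpha> / 4" using small(3) k by (simp add: field_simps)
    have "\<eta> ^ k \<le> \<eta>"
      using power_decreasing[of 1 k \<eta>] k \<eta>(1) small(4) by simp
    then have "\<eta> ^ k \<le> cmod b * R / 4" using small(5) by linarith
    then have \<eta>k: "\<eta> ^ k / cmod b \<le> R / 4" using b by (simp add: field_simps)
    define u where "u t = t ^ k / b" for t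
    have u: "u t \<in> sector_hat \<theta> (\<alpha> / 4) (R / 4)" if "t \<in> ?S" for t
      using sector_hat_power_divide[OF that k b] \<eta>(1)
        sector_hat_mono[OF k\<eta> \<eta>k, of \<theta>] by (auto simp: u_def \<theta>_def)
    have uz: "z + u t \<in> sector_hat \<theta> (\<alpha> / 2) (R / 2)" if "t \<in> ?S" "z \<in> cball 0 \<eta>" for t z
      using e(2)[OF u[OF that(1)]] that(2) small(1) by (auto simp: dist_norm)
    define G where "G t z = u t ^ i / fact i * (deriv ^^ i) g (z + u t)" for t z
    have "G t \<in> disc_space \<eta>" if t: "t \<in> ?S" for t
    proof -
      have "(deriv ^^ i) g \<circ> (\<lambda>z. z + u t) holomorphic_on cball 0 \<eta>"
        by (rule holomorphic_on_compose_gen[OF _ gi])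
          (use uz[OF t] in \<open>auto intro!: holomorphic_intros\<close>)
      then have shift: "(\<lambda>z. (deriv ^^ i) g (z + u t)) holomorphic_on cball 0 \<eta>"
        by (simp add: o_def)
      then have "G t holomorphic_on cball 0 \<eta>"
        unfolding G_def by (intro holomorphic_intros)
      then show ?thesis
        using holomorphic_on_subset[OF _ ball_subset_cball] holomorphic_on_imp_continuous_on
        by (auto simp: disc_space_def)
    qed
    moreover have "(\<lambda>t. G t z) holomorphic_on ?S" if z: "z \<in> cball 0 \<eta>" for z
    proof -
      have uh: "u holomorphic_on ?S" unfolding u_def using b by (intro holomorphic_intros) auto
      have "(deriv ^^ i) g \<circ> (\<lambda>t. z + u t) holomorphic_on ?S"
        by (rule holomorphic_on_compose_gen[OF _ gi])
          (use uz[OF _ z] uh in \<open>auto intro!: holomorphic_intros\<close>)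
      then have "(\<lambda>t. (deriv ^^ i) g (z + u t)) holomorphic_on ?S"
        by (simp add: o_def)
      then show ?thesis
        unfolding G_def using uh by (intro holomorphic_intros) auto
    qed
    moreover have "cmod (G t z) \<le> (C * exp (a * \<eta>)) * exp ((a + 1) / cmod b * cmod t ^ k)"
      if t: "t \<in> ?S" and z: "z \<in> cball 0 \<eta>" for t z
    proof -
      have "cmod (G t z) = cmod (u t) ^ i / fact i * cmod ((deriv ^^ i) g (z + u t))"
        by (simp add: G_def norm_mult norm_divide norm_power)
      \<comment> \<open>The monomial is a single term of the exponential series; this adds 1 to the
        rate \<open>a\<close>.\<close>
      also have "\<dots> \<le> exp (cmod (u t)) * (C * exp (a * (\<eta> + cmod (u t))))"
      proof (rule mult_mono)
        show "cmod (u t) ^ i / fact i \<le> exp (cmod (u t))"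
          using power_le_fact_mult_exp[of "cmod (u t)" i] by (simp add: field_simps)
        have "cmod ((deriv ^^ i) g (z + u t)) \<le> C * exp (a * cmod (z + u t))"
          using le uz[OF t z] by blast
        also have "cmod (z + u t) \<le> \<eta> + cmod (u t)"
          using norm_triangle_ineq[of z "u t"] z by simp
        finally show "cmod ((deriv ^^ i) g (z + u t)) \<le> C * exp (a * (\<eta> + cmod (u t)))"
          using Ca by (simp add: mult_left_mono)
      qed (use Ca in auto)
      also have "\<dots> = (C * exp (a * \<eta>)) * exp ((a + 1) * cmod (u t))"
        by (simp add: distrib_left distrib_right exp_add mult_ac)
      also have "cmod (u t) = cmod t ^ k / cmod b"
        by (simp add: u_def norm_divide norm_power)
      finally show ?thesis by simp
    qed
    moreover have "(\<lambda>j. binomial_geometric b i $ j * ((deriv ^^ j) f z / fact j) * (t ^ k) ^ j) sums G t z"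
      if t: "t \<in> ball 0 \<eta>" and z: "z \<in> cball 0 \<eta>" for t z
    proof -
      have zb: "cmod z \<le> \<eta>" using z by simp
      have "cmod t ^ k \<le> \<eta> ^ k" using t by (intro power_mono) auto
      then have "cmod (u t) \<le> \<eta> ^ k / cmod b"
        by (simp add: u_def norm_divide norm_power divide_right_mono)
      then have ub: "cmod (u t) < R / 2" using \<eta>k R by linarith
      have "ball z (R / 2) \<subseteq> ball 0 R"
      proof
        fix w assume "w \<in> ball z (R / 2)"
        then show "w \<in> ball 0 R"
          using zb small(6) R norm_triangle_ineq[of z "w - z"] by (simp add: dist_norm norm_minus_commute)
      qed
      then have "(deriv ^^ i) g holomorphic_on ball z (R / 2)"
        by (intro holomorphic_higher_deriv holomorphic_on_subset[OF gR]) auto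
      then have "(\<lambda>n. (deriv ^^ n) ((deriv ^^ i) g) z / fact n * (z + u t - z) ^ n) sums (deriv ^^ i) g (z + u t)"
        using ub by (intro holomorphic_power_series) (auto simp: dist_norm)
      then have "(\<lambda>n. u t ^ i / fact i * ((deriv ^^ (n + i)) g z / fact n * u t ^ n)) sums G t z"
        unfolding G_def by (intro sums_mult) (simp add: funpow_add)
      also have "(\<lambda>n. u t ^ i / fact i * ((deriv ^^ (n + i)) g z / fact n * u t ^ n))
          = (\<lambda>n. binomial_geometric b i $ (n + i) * ((deriv ^^ (n + i)) f z / fact (n + i)) * (t ^ k) ^ (n + i))"
      proof (rule ext)
        fix n
        have gf: "(deriv ^^ (n + i)) g z = (deriv ^^ (n + i)) f z"
        proof (rule higher_deriv_cong_ev)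
          have "\<forall>\<^sub>F w in nhds z. w \<in> ball 0 e0"
            using zb small(2) by (intro eventually_nhds_in_open) auto
          then show "\<forall>\<^sub>F w in nhds z. g w = f w" by eventually_elim (rule e0(2))
        qed simp
        have "of_nat (n + i choose i) = (fact (n + i) / (fact i * fact n) :: complex)"
          using binomial_fact[of i "n + i", where 'a = complex] by simp
        then show "u t ^ i / fact i * ((deriv ^^ (n + i)) g z / fact n * u t ^ n)
          = binomial_geometric b i $ (n + i) * ((deriv ^^ (n + i)) f z / fact (n + i)) * (t ^ k) ^ (n + i)"
          unfolding gf by (simp add: binomial_geometric_def u_def power_divide power_add mult_ac)
      qed
      \<comment> \<open>The Taylor series starts at index i; the lower coefficients vanish because
        \<open>j choose i\<close> is 0 for j < i.\<close>
      finally show ?thesis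
        by (subst (asm) sums_zero_iff_shift) (auto simp: binomial_geometric_def)
    qed
    ultimately show ?thesis
      unfolding borel_continues_def using Ca b
      by (intro exI[of _ G] exI[of _ "C * exp (a * \<eta>)"] exI[of _ "(a + 1) / cmod b"]) auto
  qed
  then show ?thesis
    unfolding eventually_at_right_field using \<open>E > 0\<close> by auto
qed

lemma borel_continues_fraction_span:
  assumes k: "k \<ge> 1" and r: "r > 0" and f: "f holomorphic_on ball 0 r" and B: "0 \<notin> B"
    and cont: "\<And>b. b \<in> B \<Longrightarrow> continues_with_exp_growth f 1 (real k * d - Arg b)"
    and c: "c \<in> fraction_span B"
  shows "\<forall>\<^sub>F \<eta> in at_right 0. borel_continues k d f \<eta> c"
  using c
proof induction
  case one
  have "\<forall>\<^sub>F \<eta> in at_right 0. \<eta> \<in> {0<..<r}" using r by (rule eventually_at_right_real)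
  then show ?case by eventually_elim (use borel_continues_one[OF f] in auto)
next
  case (base b i)
  then have "b \<noteq> 0" using B by metis
  then show ?case by (rule borel_continues_binomial_geometric[OF k _ cont[OF base]])
next
  case (add F G)
  from add.IH show ?case by eventually_elim (rule borel_continues_add)
next
  case (cmult F c)
  from cmult.IH show ?case by eventually_elim (rule borel_continues_cmult)
qed

text \<open>The constant depends only on \<open>M\<close> and \<open>e\<close>, so the estimate is
  uniform over a bounded family of functions. Cauchy's inequality on discs of radius e/2 bounds the
  second derivative; the mean value inequality is then applied to the derivative and to \<phi> minus
  its linear part.\<close>

lemma difference_quotient_bound:
  assumes hol: "\<phi> holomorphic_on cball t e" and e: "e > 0"
    and M: "\<And>s. s \<in> cball t e \<Longrightarrow> cmod (\<phi> s) \<le> M"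
    and h: "h \<noteq> 0" "cmod h < e / 2"
  shows "cmod ((\<phi> (t + h) - \<phi> t) / h - deriv \<phi> t) \<le> (2 * M / (e / 2)\<^sup>2) * cmod h"
proof -
  define K where "K = 2 * M / (e / 2)\<^sup>2"
  let ?S = "cball t (cmod h)"
  have sub: "ball t e \<subseteq> cball t e" by auto
  have holb: "\<phi> holomorphic_on ball t e" using hol sub by (rule holomorphic_on_subset)
  have S: "?S \<subseteq> ball t e" using h e by auto
  have d1: "(\<phi> has_field_derivative deriv \<phi> s) (at s)" if "s \<in> ball t e" for s
    using holb open_ball that by (rule holomorphic_derivI)
  have d2: "(deriv \<phi> has_field_derivative (deriv ^^ 2) \<phi> s) (at s)" if "s \<in> ball t e" for s
    using holomorphic_derivI[OF holomorphic_deriv[OF holb open_ball] open_ball that]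
    by (simp add: numeral_2_eq_2)
  have K: "cmod ((deriv ^^ 2) \<phi> s) \<le> K" if s: "s \<in> ?S" for s
  proof -
    have sub: "cball s (e / 2) \<subseteq> cball t e"
    proof
      fix w assume "w \<in> cball s (e / 2)"
      then show "w \<in> cball t e"
        using s h(2) dist_triangle[of t w s] by simp
    qed
    have "cmod ((deriv ^^ 2) \<phi> s) \<le> fact 2 * M / (e / 2) ^ 2"
    proof (rule Cauchy_inequality)
      show "\<phi> holomorphic_on ball s (e / 2)"
        by (rule holomorphic_on_subset[OF hol order_trans[OF ball_subset_cball sub]])
      show "continuous_on (cball s (e / 2)) \<phi>"
        by (rule holomorphic_on_imp_continuous_on[OF holomorphic_on_subset[OF hol sub]])
      show "cmod (\<phi> w) \<le> M" if "cmod (s - w) = e / 2" for w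
        using that sub by (intro M) (auto simp: dist_norm)
    qed (use e in simp)
    then show ?thesis by (simp add: K_def)
  qed
  have dd: "cmod (deriv \<phi> s - deriv \<phi> t) \<le> K * cmod h" if s: "s \<in> ?S" for s
  proof -
    have "cmod (deriv \<phi> s - deriv \<phi> t) \<le> K * cmod (s - t)"
    proof (rule field_differentiable_bound[where S = ?S and f' = "(deriv ^^ 2) \<phi>"])
      show "(deriv \<phi> has_field_derivative (deriv ^^ 2) \<phi> w) (at w within ?S)" if "w \<in> ?S" for w
        using has_field_derivative_at_within[OF d2] S that by blast
    qed (use s K in auto)
    also have "\<dots> \<le> K * cmod h"
      using s order_trans[OF norm_ge_zero K[of t]]
      by (intro mult_left_mono) (auto simp: dist_norm norm_minus_commute)
    finally show ?thesis .
  qed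
  have "cmod ((\<phi> (t + h) - (t + h) * deriv \<phi> t) - (\<phi> t - t * deriv \<phi> t)) \<le> K * cmod h * cmod ((t + h) - t)"
  proof (rule field_differentiable_bound[where S = ?S and f' = "\<lambda>s. deriv \<phi> s - deriv \<phi> t"
        and f = "\<lambda>s. \<phi> s - s * deriv \<phi> t"])
    show "((\<lambda>s. \<phi> s - s * deriv \<phi> t) has_field_derivative deriv \<phi> s - deriv \<phi> t) (at s within ?S)"
      if "s \<in> ?S" for s
      using has_field_derivative_at_within[OF d1] S that by (auto intro!: derivative_eq_intros)
  qed (use dd in \<open>auto simp: dist_norm\<close>)
  then have "cmod (\<phi> (t + h) - \<phi> t - h * deriv \<phi> t) \<le> K * cmod h * cmod h"
    by (simp add: algebra_simps)
  moreover have "(\<phi> (t + h) - \<phi> t) / h - deriv \<phi> t = (\<phi> (t + h) - \<phi> t - h * deriv \<phi> t) / h"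
    using h by (simp add: field_simps)
  ultimately show ?thesis
    using h by (simp add: norm_divide divide_le_eq flip: K_def)
qed

text \<open>Continuity of \<open>M\<close> gives one bound on a closed disc around t, so the
  difference quotients converge uniformly in z. The pointwise derivative thus lies in the space as a
  uniform limit, and convergence holds in norm.\<close>

lemma disc_holomorphic_onI:
  assumes \<Omega>: "open \<Omega>" and r: "r > 0"
    and G: "\<And>t. t \<in> \<Omega> \<Longrightarrow> G t \<in> disc_space r"
    and hol: "\<And>z. z \<in> cball 0 r \<Longrightarrow> (\<lambda>t. G t z) holomorphic_on \<Omega>"
    and bound: "\<And>t. t \<in> \<Omega> \<Longrightarrow> \<forall>z\<in>cball 0 r. cmod (G t z) \<le> M t"
    and M: "continuous_on \<Omega> M"
  shows "disc_holomorphic_on r G \<Omega>"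
  unfolding disc_holomorphic_on_def
proof (intro ballI conjI G)
  fix t assume t: "t \<in> \<Omega>"
  then obtain e where e: "e > 0" "cball t e \<subseteq> \<Omega>"
    using \<Omega> open_contains_cball by blast
  have "compact (M ` cball t e)"
    using M e(2) by (intro compact_continuous_image) (auto intro: continuous_on_subset)
  then have "bdd_above (M ` cball t e)"
    by (intro bounded_imp_bdd_above compact_imp_bounded)
  then obtain B where B: "\<forall>y\<in>M ` cball t e. y \<le> B"
    unfolding bdd_above_def by (rule exE)
  have GB: "cmod (G s z) \<le> B" if "s \<in> cball t e" "z \<in> cball 0 r" for s z
  proof -
    have "s \<in> \<Omega>" using that(1) e(2) by blast
    then have "cmod (G s z) \<le> M s" using bound that(2) by blast
    also have "M s \<le> B" using B that(1) by blast
    finally show ?thesis .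
  qed
  define D where "D z = deriv (\<lambda>t. G t z) t" for z
  define K where "K = 2 * B / (e / 2)\<^sup>2"
  let ?q = "\<lambda>h z. (G (t + h) z - G t z) / h"
  have q: "cmod (?q h z - D z) \<le> K * cmod h" if "h \<noteq> 0" "cmod h < e / 2" "z \<in> cball 0 r" for h z
    unfolding D_def K_def using hol[OF that(3)] e(2) GB[OF _ that(3)]
    by (intro difference_quotient_bound[OF _ e(1) _ that(1,2)]) (auto intro: holomorphic_on_subset)
  have ev: "\<forall>\<^sub>F h in at 0. h \<noteq> 0 \<and> cmod h < e / 2"
    unfolding eventually_at using e(1) by (intro exI[of _ "e / 2"]) auto
  have qd: "?q h \<in> disc_space r" if "h \<noteq> 0" "cmod h < e / 2" for h
  proof -
    have "t + h \<in> \<Omega>" using e that by (auto simp: dist_norm subset_eq)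
    then show ?thesis
      using disc_space_cmult[OF disc_space_diff[OF G G[OF t]], of "t + h" "1 / h"] by simp
  qed
  have K: "((\<lambda>h. K * cmod h) \<longlongrightarrow> 0) (at 0)"
    by (auto intro!: tendsto_eq_intros)
  have D: "D \<in> disc_space r"
  proof -
    have "uniform_limit (cball 0 r) ?q D (at 0)"
    proof (rule uniform_limitI)
      fix \<epsilon> :: real assume "\<epsilon> > 0"
      then have "\<forall>\<^sub>F h in at 0. K * cmod h < \<epsilon>" using K by (rule order_tendstoD(2)[rotated])
      with ev show "\<forall>\<^sub>F h in at 0. \<forall>z\<in>cball 0 r. dist (?q h z) (D z) < \<epsilon>"
      proof eventually_elim
        case (elim h)
        show ?case
        proof
          fix z :: complex assume "z \<in> cball 0 r"
          then have "cmod (?q h z - D z) \<le> K * cmod h" using elim(1) by (intro q) auto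
          also have "\<dots> < \<epsilon>" by (rule elim(2))
          finally show "dist (?q h z) (D z) < \<epsilon>" by (simp add: dist_norm)
        qed
      qed
    qed
    moreover have "\<forall>\<^sub>F h in at 0. continuous_on (cball 0 r) (?q h) \<and> ?q h holomorphic_on ball 0 r"
      using ev by eventually_elim (use qd in \<open>auto simp: disc_space_def\<close>)
    ultimately show ?thesis
      unfolding disc_space_def using holomorphic_uniform_limit[of 0 r ?q "at 0" D] by auto
  qed
  have "((\<lambda>h. disc_norm r (\<lambda>z. ?q h z - D z)) \<longlongrightarrow> 0) (at 0)"
  proof (rule Lim_null_comparison[OF _ K])
    show "\<forall>\<^sub>F h in at 0. norm (disc_norm r (\<lambda>z. ?q h z - D z)) \<le> K * cmod h"
      using ev
    proof eventually_elim
      case (elim h)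
      have "(\<lambda>z. ?q h z - D z) \<in> disc_space r" using elim qd D by (intro disc_space_diff) auto
      then have "disc_norm r (\<lambda>z. ?q h z - D z) \<ge> 0" using r by (intro disc_norm_nonneg) auto
      moreover have "disc_norm r (\<lambda>z. ?q h z - D z) \<le> K * cmod h"
        using r q elim by (intro disc_norm_least) auto
      ultimately show ?case by simp
    qed
  qed
  with D show "\<exists>D\<in>disc_space r. ((\<lambda>h. disc_norm r (\<lambda>z. ?q h z - D z)) \<longlongrightarrow> 0) (at 0)"
    by blast
qed

lemma disc_sumsI:
  assumes r: "r \<ge> 0" and \<phi>: "\<phi> \<in> disc_space r" and u: "\<And>n. u n \<in> disc_space r"
    and sums: "\<And>z. z \<in> cball 0 r \<Longrightarrow> (\<lambda>n. u n z) sums \<phi> z"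
    and bound: "\<And>n z. z \<in> cball 0 r \<Longrightarrow> cmod (u n z) \<le> M n" and M: "summable M"
  shows "disc_sums r u \<phi>"
  unfolding disc_sums_def
proof (intro conjI \<phi> LIMSEQ_I)
  fix \<epsilon> :: real assume \<epsilon>: "\<epsilon> > 0"
  have "uniform_limit (cball 0 r) (\<lambda>N z. \<Sum>n<N. u n z) (\<lambda>z. \<Sum>n. u n z) sequentially"
    using bound M by (rule Weierstrass_m_test)
  then have "\<forall>\<^sub>F N in sequentially. \<forall>z\<in>cball 0 r. dist (\<Sum>n<N. u n z) (\<Sum>n. u n z) < \<epsilon> / 2"
    using \<epsilon> by (intro uniform_limitD) auto
  then obtain N0 where N0: "\<And>N z. N \<ge> N0 \<Longrightarrow> z \<in> cball 0 r \<Longrightarrow> dist (\<Sum>n<N. u n z) (\<Sum>n. u n z) < \<epsilon> / 2"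
    unfolding eventually_sequentially by blast
  have "norm (disc_norm r (\<lambda>z. (\<Sum>n<N. u n z) - \<phi> z) - 0) < \<epsilon>" if "N \<ge> N0" for N
  proof -
    let ?e = "\<lambda>z. (\<Sum>n<N. u n z) - \<phi> z"
    have "disc_norm r ?e \<le> \<epsilon> / 2"
    proof (rule disc_norm_least[OF r])
      fix z :: complex assume z: "z \<in> cball 0 r"
      have "(\<Sum>n. u n z) = \<phi> z" using sums[OF z] by (simp add: sums_iff)
      then show "cmod (?e z) \<le> \<epsilon> / 2" using N0[OF that z] by (simp add: dist_norm)
    qed
    moreover have "disc_norm r ?e \<ge> 0"
      using r \<phi> u by (intro disc_norm_nonneg disc_space_diff disc_space_sum)
    ultimately show ?thesis using \<epsilon> by simp
  qed
  then show "\<exists>N0. \<forall>N\<ge>N0. norm (disc_norm r (\<lambda>z. (\<Sum>n<N. u n z) - \<phi> z) - 0) < \<epsilon>" by blast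
qed

lemma power_series_coeff_bound:
  assumes hol: "g holomorphic_on ball 0 R" and \<rho>: "0 < \<rho>" "\<rho> < R"
    and sums: "\<And>t. t \<in> ball 0 R \<Longrightarrow> (\<lambda>n. b n * t ^ n) sums g t"
    and M: "\<And>t. cmod t = \<rho> \<Longrightarrow> cmod (g t) \<le> M"
  shows "cmod (b n) \<le> M / \<rho> ^ n"
proof -
  have "g has_fps_expansion Abs_fps b"
  proof (rule has_fps_expansionI)
    have "\<forall>\<^sub>F t in nhds 0. t \<in> ball 0 R" using \<rho> by (intro eventually_nhds_in_open) auto
    then show "\<forall>\<^sub>F t in nhds 0. (\<lambda>n. Abs_fps b $ n * t ^ n) sums g t"
      by eventually_elim (use sums in simp)
  qed
  then have "b n = (deriv ^^ n) g 0 / fact n"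
    using fps_nth_fps_expansion[of g "Abs_fps b" n] by simp
  then have "cmod (b n) = cmod ((deriv ^^ n) g 0) / fact n"
    by (simp add: norm_divide)
  also have "\<dots> \<le> (fact n * M / \<rho> ^ n) / fact n"
  proof (intro divide_right_mono Cauchy_inequality)
    show "g holomorphic_on ball 0 \<rho>" "continuous_on (cball 0 \<rho>) g"
      using hol \<rho> by (auto intro!: holomorphic_on_imp_continuous_on intro: holomorphic_on_subset)
  qed (use \<rho> M in auto)
  also have "\<dots> = M / \<rho> ^ n" by simp
  finally show ?thesis .
qed

text \<open>Cauchy estimates in t bound the coefficients independently of z, which upgrades the
  pointwise expansion to convergence in norm on a smaller disc.\<close>

lemma borel_continues_imp_formal_summable:
  assumes k: "k \<ge> 1" and P0: "poly P 0 \<noteq> 0" and f: "f holomorphic_on ball 0 r"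
    and x: "formal_solution r P k f x" and \<eta>: "0 < \<eta>" "\<eta> < r"
    and good: "borel_continues k d f \<eta> (inverse (fps_of_poly P))"
  shows "formal_summable \<eta> (real k) d x"
proof -
  define c where "c = inverse (fps_of_poly P)"
  let ?S = "sector_hat d \<eta> \<eta>"
  obtain G C a where G: "C \<ge> 0" "a \<ge> 0" "\<forall>t\<in>?S. G t \<in> disc_space \<eta>"
    "\<forall>z\<in>cball 0 \<eta>. (\<lambda>t. G t z) holomorphic_on ?S"
    "\<forall>t\<in>?S. \<forall>z\<in>cball 0 \<eta>. cmod (G t z) \<le> C * exp (a * cmod t ^ k)"
    "\<forall>t\<in>ball 0 \<eta>. \<forall>z\<in>cball 0 \<eta>. (\<lambda>j. c $ j * ((deriv ^^ j) f z / fact j) * (t ^ k) ^ j) sums G t z"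
    using good unfolding borel_continues_def c_def by blast
  have xd: "x n \<in> disc_space \<eta>" for n
  proof -
    have "x n \<in> disc_space r" using x by (simp add: formal_solution_def)
    then show ?thesis
      using \<eta> unfolding disc_space_def
      by (auto intro: holomorphic_on_subset continuous_on_subset)
  qed
  have bd: "formal_borel (real k) x n \<in> disc_space \<eta>" for n
    using disc_space_cmult[OF xd[of n], of "1 / of_real (Gamma (1 + real n / real k))"]
    unfolding formal_borel_def by simp
  have powr: "cmod t powr real k = cmod t ^ k" for t
    using k by (cases "t = 0") (auto simp: powr_realpow)
  have sums: "(\<lambda>n. formal_borel (real k) x n z * t ^ n) sums G t z"
    if t: "t \<in> ball 0 \<eta>" and z: "z \<in> cball 0 \<eta>" for t z
  proof -
    have zr: "z \<in> ball 0 r" using z \<eta> by simp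
    have "formal_borel (real k) x n z
        = (if k dvd n then c $ (n div k) * ((deriv ^^ (n div k)) f z / fact (n div k)) else 0)" for n
    proof -
      have "Gamma (1 + real n / real k) = fact (n div k)" if "k dvd n"
        using that k Gamma_fact[of "n div k", where 'a = real] by (auto simp: dvd_def)
      then show ?thesis
        using formal_solution_coeff[OF k P0 f x zr, of n] by (simp add: formal_borel_def c_def)
    qed
    then show ?thesis
      using sums_multiples_iff[OF k, of "\<lambda>m. c $ m * ((deriv ^^ m) f z / fact m)" t "G t z"]
        G(6) t z by simp
  qed
  have "disc_holomorphic_on \<eta> G ?S"
    by (rule disc_holomorphic_onI[where M = "\<lambda>t. C * exp (a * cmod t ^ k)"])
      (use G \<eta> in \<open>auto intro!: open_sector_hat continuous_intros\<close>)
  moreover have "exp_growth (real k) d \<eta> \<eta> (\<lambda>t. disc_norm \<eta> (G t))"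
  proof (rule exp_growth_uniform)
    fix t assume "t \<in> ?S"
    then show "disc_norm \<eta> (G t) \<le> C * exp (a * cmod t powr real k)"
      unfolding powr using G(5) \<eta> by (intro disc_norm_least) auto
  qed
  moreover have "disc_sums \<eta> (\<lambda>n z. formal_borel (real k) x n z * t ^ n) (G t)"
    if t: "t \<in> ball 0 (\<eta> / 2)" for t
  proof (rule disc_sumsI)
    \<comment> \<open>A radius between \<eta>/2, which bounds t, and \<eta>, below which
      \<open>G\<close> is controlled; the terms are then dominated by a geometric series of ratio
      (\<eta>/2)/\<rho> = 2/3.\<close>
    define \<rho> where "\<rho> = 3 / 4 * \<eta>"
    define M where "M = C * exp (a * \<rho> ^ k)"
    have \<rho>: "0 < \<rho>" "\<rho> < \<eta>" using \<eta> by (auto simp: \<rho>_def)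
    have t': "t \<in> ball 0 \<eta>" using t \<eta>(1) by simp
    then have "t \<in> ?S" by (simp add: sector_hat_def)
    then show "G t \<in> disc_space \<eta>" using G(3) by blast
    show "(\<lambda>z. formal_borel (real k) x n z * t ^ n) \<in> disc_space \<eta>" for n
      using disc_space_cmult[OF bd[of n], of "t ^ n"] by (simp add: mult.commute)
    show "(\<lambda>n. formal_borel (real k) x n z * t ^ n) sums G t z" if "z \<in> cball 0 \<eta>" for z
      by (rule sums[OF t' that])
    show "cmod (formal_borel (real k) x n z * t ^ n) \<le> M * (2 / 3) ^ n" if z: "z \<in> cball 0 \<eta>" for n z
    proof -
      have "cmod (formal_borel (real k) x n z) \<le> M / \<rho> ^ n"
      proof (rule power_series_coeff_bound[OF _ \<rho> sums[OF _ z]])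
        show "(\<lambda>t. G t z) holomorphic_on ball 0 \<eta>"
          using G(4) z by (auto intro: holomorphic_on_subset simp: sector_hat_def)
        fix s assume s: "cmod s = \<rho>"
        then have "s \<in> ?S" using \<rho> by (simp add: sector_hat_def)
        then show "cmod (G s z) \<le> M" using G(5) z s by (auto simp: M_def)
      qed
      moreover have "cmod t ^ n \<le> (\<eta> / 2) ^ n" using t by (intro power_mono) auto
      ultimately have "cmod (formal_borel (real k) x n z * t ^ n) \<le> M / \<rho> ^ n * (\<eta> / 2) ^ n"
        using G(1) \<rho>(1) unfolding norm_mult norm_power by (intro mult_mono) (auto simp: M_def)
      also have "M / \<rho> ^ n * (\<eta> / 2) ^ n = M * ((\<eta> / 2) / \<rho>) ^ n" by (simp add: power_divide)
      also have "(\<eta> / 2) / \<rho> = 2 / 3" using \<eta> by (simp add: \<rho>_def)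
      finally show ?thesis .
    qed
    show "summable (\<lambda>n. M * (2 / 3) ^ n)" by (intro summable_mult summable_geometric) simp
  qed (use \<eta> in auto)
  ultimately show ?thesis
    unfolding formal_summable_def using xd \<eta>(1) half_gt_zero[OF \<eta>(1)] by blast
qed

theorem theorem1:
  fixes k q l :: nat and d r :: real and P :: "complex poly"
    and a :: "nat \<Rightarrow> complex" and p :: "nat \<Rightarrow> nat"
    and U :: "complex set" and f :: "complex \<Rightarrow> complex"
    and x :: "nat \<Rightarrow> complex \<Rightarrow> complex"
  assumes "k \<ge> 1"
    and "degree P = q" and "poly P 0 \<noteq> 0"
    and "inj_on a {1..l}" and "a ` {1..l} = {\<zeta>. poly P \<zeta> = 0}"
    and "\<And>i. i \<in> {1..l} \<Longrightarrow> p i = order (a i) P" and "(\<Sum>i=1..l. p i) = q"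
    and "open U" and "0 \<in> U" and "f holomorphic_on U"
    and "r > 0" and "ball 0 r \<subseteq> U" and "formal_solution r P k f x"
  shows "(\<forall>i\<in>{1..l}. continues_with_exp_growth f 1 (real k * d - Arg (a i))) \<longleftrightarrow>
         (\<exists>r'. 0 < r' \<and> r' \<le> r \<and> formal_summable r' (real k) d x)"
proof
  have f: "f holomorphic_on ball 0 r" using assms(10,12) by (rule holomorphic_on_subset)
  let ?B = "{\<zeta>. poly P \<zeta> = 0}"
  {
    assume cont: "\<forall>i\<in>{1..l}. continues_with_exp_growth f 1 (real k * d - Arg (a i))"
    have "continues_with_exp_growth f 1 (real k * d - Arg b)" if "b \<in> ?B" for b
      using that cont unfolding assms(5)[symmetric] by blast
    moreover have "0 \<notin> ?B" using assms(3) by simp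
    ultimately have "\<forall>\<^sub>F \<eta> in at_right 0. borel_continues k d f \<eta> (inverse (fps_of_poly P))"
      using inverse_poly_in_fraction_span[OF assms(3) order_refl]
      by (intro borel_continues_fraction_span[OF assms(1,11) f, of ?B]) auto
    \<comment> \<open>Below \<open>r\<close> the closed disc lies in the open one, where the
      equation determines the coefficients.\<close>
    moreover have "\<forall>\<^sub>F \<eta> in at_right 0. \<eta> \<in> {0<..<r}"
      using assms(11) by (rule eventually_at_right_real)
    ultimately have "\<forall>\<^sub>F \<eta> in at_right 0. \<eta> \<in> {0<..<r} \<and> formal_summable \<eta> (real k) d x"
      by eventually_elim (use borel_continues_imp_formal_summable[OF assms(1,3) f assms(13)] in auto)
    then obtain \<eta> where "\<eta> \<in> {0<..<r}" "formal_summable \<eta> (real k) d x"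
      using eventually_happens' trivial_limit_at_right_real by blast
    then show "\<exists>r'. 0 < r' \<and> r' \<le> r \<and> formal_summable r' (real k) d x"
      by (intro exI[of _ \<eta>]) auto
  next
    assume "\<exists>r'. 0 < r' \<and> r' \<le> r \<and> formal_summable r' (real k) d x"
    then obtain r' where r': "0 < r'" "r' \<le> r" "formal_summable r' (real k) d x" by blast
    show "\<forall>i\<in>{1..l}. continues_with_exp_growth f 1 (real k * d - Arg (a i))"
    proof
      fix i assume "i \<in> {1..l}"
      then have "poly P (a i) = 0" using assms(5) by blast
      then show "continues_with_exp_growth f 1 (real k * d - Arg (a i))"
        by (rule formal_summable_imp_continues[OF assms(1,3) _ f assms(13) r'])
    qed
  }
qed

end
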